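(* Let $a_h$ be an admissible symmetric bilinear form on $V_h$ and let $\langle\cdot,\cdot\rangle_h$ be any admissible inner product on $V_h$, and let $h$ be small enough that $a_h$ is positive definite on $V_h$. Let $T_h=L_h^{-1}P_h:L^2(\mathcal S)\to V_h$, where $\langle L_h\chi,\psi\rangle_h=a_h(\chi,\psi)$ and $\langle P_hf,\chi\rangle_h=(f,Q\chi)$ for all $\chi,\psi\in V_h$, $f\in L^2(\mathcal S)$. Let $L_{h,Q}:V_h\to V_h$ and $P_{h,Q}:L^2(\mathcal S)\to V_h$ be the operators defined in the same way from the same form $a_h$ but with the lumped-mass inner product $\langle\chi,\psi\rangle_Q=(Q\chi,Q\psi)$, i.e. $\langle L_{h,Q}\chi,\psi\rangle_Q=a_h(\chi,\psi)$ and $\langle P_{h,Q}f,\chi\rangle_Q=(f,Q\chi)$, and set $T^Q_{h,\beta}:=(L_{h,Q})^{-\beta}P_{h,Q}$. Then for every $\beta>0$, $$T^Q_{h,\beta}=Q^{-1}(QT_h)^{\beta}.$$ In particular, $T^Q_{h,\beta}$ depends only on $T_h$ and is therefore independent of the auxiliary inner product $\langle\cdot,\cdot\rangle_h$ used to represent the nonfractional problem.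
   Context: Setting: $d\in\{1,2,3\}$; $\mathcal S\subset\mathbb R^d$ is a bounded convex (open) interval, polygon or polyhedron; $A\in W^{1,\infty}(\mathcal S;\mathbb R^{d\times d})$ is symmetric and uniformly elliptic; $\kappa\in W^{1,\infty}(\mathcal S)$ with $\kappa\ge\kappa_0>0$. $(\cdot,\cdot)$, $\|\cdot\|$ are the $L^2(\mathcal S)$ inner product and norm, $|v|_1=\|\nabla v\|$. $\mathcal V=H^1_0(\mathcal S)$ (homogeneous Dirichlet case) or $\mathcal V=H^1(\mathcal S)$ (homogeneous Neumann case), and $a(u,v)=\int_{\mathcal S}A\nabla u\cdot\nabla v\,dx+\int_{\mathcal S}\kappa^2uv\,dx$ on $\mathcal V$. Mesh: $\{\mathcal T_h\}_{h\downarrow0}$ is a family of conforming simplicial triangulations of $\overline{\mathcal S}$, $h=\max_{K}h_K$, $h_K=\operatorname{diam}K$, shape regular (there is $\sigma_{\rm sr}>0$ with $\rho_K\ge\sigma_{\rm sr}h_K$ for all $K\in\mathcal T_h$ and all $h$, $\rho_K$ the diameter of the largest ball in $K$). $\mathcal Z_h^{\rm act}$ is the set of active vertices: vertices not on $\partial\mathcal S$ in the Dirichlet case, all vertices in the Neumann case. $\phi_z$ is the continuous piecewise affine nodal basis function of $z$, and $V_h=\operatorname{span}\{\phi_z:z\in\mathcal Z_h^{\rm act}\}\subset\mathcal V$. Dual mesh: for $K\in\mathcal T_h$ and a vertex $z$ of $K$, $\mathcal A_z(K)$ is the convex hull of the barycenters of all $k$-dimensional faces of $K$, $0\le k\le d$,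 that contain $z$ (including $z$ itself and the barycenter of $K$); $b_z=\bigcup_{K\ni z}\mathcal A_z(K)$. $V_{0,h}=\operatorname{span}\{\mathbf 1_{b_z}:z\in\mathcal Z_h^{\rm act}\}$ and $Q:V_h\to V_{0,h}$, $Q\chi=\sum_{z\in\mathcal Z_h^{\rm act}}\chi(z)\mathbf 1_{b_z}$, a linear isomorphism. Admissibility ($X\lesssim Y$ means $X\le CY$ with $C$ independent of $h$; $\simeq$ is two-sided). An inner product $\langle\cdot,\cdot\rangle_h$ on $V_h$ with norm $\|\cdot\|_h$ is admissible if, uniformly in $h$, $|(\chi,\psi)-\langle\chi,\psi\rangle_h|\lesssim h^2|\chi|_1|\psi|_1$ and $\|\chi\|_h\simeq\|\chi\|$ for all $\chi,\psi\in V_h$. A symmetric bilinear form $a_h$ on $V_h$ is admissible if it is continuous on $V_h\times V_h$ and, uniformly in $h$, $|a(\chi,\psi)-a_h(\chi,\psi)|\lesssim h^2|\chi|_1|\psi|_1$ for all $\chi,\psi\in V_h$. (An admissible $a_h$ is coercive on $V_h$ for all sufficiently small $h$.) Fractional powers: $(L_{h,Q})^{-\beta}$ is defined by the spectral theorem for the positive selfadjoint operator $L_{h,Q}$ on $(V_h,\langle\cdot,\cdot\rangle_Q)$. The operator $QT_h:L^2(\mathcal S)\to V_{0,h}\subset L^2(\mathcal S)$ is selfadjoint and nonnegative on $L^2(\mathcal S)$; $(QT_h)^\beta$ is its power by spectral calculus (with $0^\beta=0$), whose range lies in $V_{0,h}$. *)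

theory Defs
  imports "HOL-Analysis.Analysis"
begin

section \<open>Lebesgue and Sobolev spaces on a domain\<close>

text \<open>Elements of \<open>L\<^sup>2(S)\<close> are represented by functions on the whole space whose values outside \<open>S\<close>
  are irrelevant; equality in \<open>L\<^sup>2(S)\<close> is equality almost everywhere on \<open>S\<close>.\<close>

definition L2_space :: "(real^'d) set \<Rightarrow> (real^'d \<Rightarrow> real) set" where
  "L2_space S = {f. f \<in> borel_measurable (lebesgue_on S) \<and> integrable (lebesgue_on S) (\<lambda>x. (f x)\<^sup>2)}"

definition L2_inner :: "(real^'d) set \<Rightarrow> (real^'d \<Rightarrow> real) \<Rightarrow> (real^'d \<Rightarrow> real) \<Rightarrow> real" where
  "L2_inner S f g = (LINT x|lebesgue_on S. f x * g x)"

definition L2_norm :: "(real^'d) set \<Rightarrow> (real^'d \<Rightarrow> real) \<Rightarrow> real" where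
  "L2_norm S f = sqrt (L2_inner S f f)"

definition Linf :: "(real^'d) set \<Rightarrow> (real^'d \<Rightarrow> real) \<Rightarrow> bool" where
  "Linf S f \<longleftrightarrow> f \<in> borel_measurable (lebesgue_on S) \<and> (\<exists>C. AE x in lebesgue_on S. \<bar>f x\<bar> \<le> C)"

definition partial :: "'d \<Rightarrow> (real^'d \<Rightarrow> real) \<Rightarrow> real^'d \<Rightarrow> real" where
  "partial i f x = frechet_derivative f (at x) (axis i 1)"

fun Ck :: "nat \<Rightarrow> (real^'d \<Rightarrow> real) \<Rightarrow> bool" where
  "Ck 0 f \<longleftrightarrow> continuous_on UNIV f"
| "Ck (Suc k) f \<longleftrightarrow> (\<forall>x. f differentiable (at x)) \<and> (\<forall>i. Ck k (partial i f))"

definition test_function :: "(real^'d) set \<Rightarrow> (real^'d \<Rightarrow> real) \<Rightarrow> bool" where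
  "test_function S \<phi> \<longleftrightarrow>
     (\<forall>k. Ck k \<phi>) \<and> compact (closure {x. \<phi> x \<noteq> 0}) \<and> closure {x. \<phi> x \<noteq> 0} \<subseteq> S"

definition has_weak_gradient ::
    "(real^'d) set \<Rightarrow> (real^'d \<Rightarrow> real) \<Rightarrow> (real^'d \<Rightarrow> real^'d) \<Rightarrow> bool" where
  "has_weak_gradient S u g \<longleftrightarrow>
     (\<forall>C. compact C \<and> C \<subseteq> S \<longrightarrow> integrable (lebesgue_on C) u \<and> integrable (lebesgue_on C) g) \<and>
     (\<forall>\<phi> i. test_function S \<phi> \<longrightarrow>
        (LINT x|lebesgue_on S. u x * partial i \<phi> x) = - (LINT x|lebesgue_on S. g x $ i * \<phi> x))"

text \<open>Unique up to equality almost everywhere on \<open>S\<close>, whenever it exists.\<close>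

definition weak_gradient :: "(real^'d) set \<Rightarrow> (real^'d \<Rightarrow> real) \<Rightarrow> real^'d \<Rightarrow> real^'d" where
  "weak_gradient S u = (SOME g. has_weak_gradient S u g)"

definition W1inf :: "(real^'d) set \<Rightarrow> (real^'d \<Rightarrow> real) \<Rightarrow> bool" where
  "W1inf S u \<longleftrightarrow> Linf S u \<and> (\<exists>g. has_weak_gradient S u g \<and> (\<forall>i. Linf S (\<lambda>x. g x $ i)))"

definition H1_seminorm :: "(real^'d) set \<Rightarrow> (real^'d \<Rightarrow> real) \<Rightarrow> real" where
  "H1_seminorm S v = sqrt (LINT x|lebesgue_on S. (norm (weak_gradient S v x))\<^sup>2)"

definition H1_norm :: "(real^'d) set \<Rightarrow> (real^'d \<Rightarrow> real) \<Rightarrow> real" where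
  "H1_norm S v = sqrt ((L2_norm S v)\<^sup>2 + (H1_seminorm S v)\<^sup>2)"


section \<open>The continuous problem\<close>

definition polytopal_domain :: "(real^'d) set \<Rightarrow> bool" where
  "polytopal_domain S \<longleftrightarrow> open S \<and> S \<noteq> {} \<and> bounded S \<and> convex S \<and> polytope (closure S)"

definition admissible_coefficients ::
    "(real^'d) set \<Rightarrow> (real^'d \<Rightarrow> real^'d^'d) \<Rightarrow> (real^'d \<Rightarrow> real) \<Rightarrow> bool" where
  "admissible_coefficients S A \<kappa> \<longleftrightarrow>
     (\<forall>i j. W1inf S (\<lambda>x. A x $ i $ j)) \<and>
     (AE x in lebesgue_on S. transpose (A x) = A x) \<and>
     (\<exists>\<alpha>>0. AE x in lebesgue_on S. \<forall>\<xi>. \<alpha> * (norm \<xi>)\<^sup>2 \<le> (A x *v \<xi>) \<bullet> \<xi>) \<and>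
     W1inf S \<kappa> \<and>
     (\<exists>\<kappa>0>0. AE x in lebesgue_on S. \<kappa>0 \<le> \<kappa> x)"

definition energy_form ::
    "(real^'d) set \<Rightarrow> (real^'d \<Rightarrow> real^'d^'d) \<Rightarrow> (real^'d \<Rightarrow> real) \<Rightarrow>
     (real^'d \<Rightarrow> real) \<Rightarrow> (real^'d \<Rightarrow> real) \<Rightarrow> real" where
  "energy_form S A \<kappa> u v =
     (LINT x|lebesgue_on S. (A x *v weak_gradient S u x) \<bullet> weak_gradient S v x) +
     (LINT x|lebesgue_on S. (\<kappa> x)\<^sup>2 * u x * v x)"


section \<open>Meshes and finite element spaces\<close>

definition conforming_mesh :: "(real^'d) set \<Rightarrow> (real^'d) set set \<Rightarrow> bool" where
  "conforming_mesh S T \<longleftrightarrow>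
     triangulation T \<and> (\<forall>K\<in>T. int CARD('d) simplex K) \<and> \<Union>T = closure S"

definition inball_diameter :: "(real^'d) set \<Rightarrow> real" where
  "inball_diameter K = 2 * Sup {r. 0 \<le> r \<and> (\<exists>x. cball x r \<subseteq> K)}"

text \<open>The family \<open>T\<close> is indexed by the mesh sizes \<open>h\<close> in a set \<open>H\<close> of positive reals accumulating at \<open>0\<close>.\<close>

definition mesh_family :: "(real^'d) set \<Rightarrow> real set \<Rightarrow> (real \<Rightarrow> (real^'d) set set) \<Rightarrow> bool" where
  "mesh_family S H T \<longleftrightarrow>
     H \<subseteq> {0<..} \<and> 0 islimpt H \<and>
     (\<forall>h\<in>H. conforming_mesh S (T h) \<and> h = Max (diameter ` T h)) \<and>
     (\<exists>\<sigma>>0. \<forall>h\<in>H. \<forall>K\<in>T h. \<sigma> * diameter K \<le> inball_diameter K)"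

datatype boundary_condition = Dirichlet | Neumann

definition mesh_vertices :: "(real^'d) set set \<Rightarrow> (real^'d) set" where
  "mesh_vertices T = {z. \<exists>K\<in>T. z extreme_point_of K}"

definition active_vertices ::
    "boundary_condition \<Rightarrow> (real^'d) set \<Rightarrow> (real^'d) set set \<Rightarrow> (real^'d) set" where
  "active_vertices bc S T =
     (case bc of Dirichlet \<Rightarrow> mesh_vertices T - frontier S | Neumann \<Rightarrow> mesh_vertices T)"

text \<open>Finite element functions live on \<open>\<Union>T = closure S\<close>; they are extended by \<open>0\<close> to the whole space, so
  that equality of finite element functions is equality in HOL.\<close>

definition nodal_basis :: "(real^'d) set set \<Rightarrow> real^'d \<Rightarrow> real^'d \<Rightarrow> real" where
  "nodal_basis T z = (THE \<phi>.
     continuous_on (\<Union>T) \<phi> \<and>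
     (\<forall>K\<in>T. \<exists>a b. \<forall>x\<in>K. \<phi> x = a \<bullet> x + b) \<and>
     (\<forall>w\<in>mesh_vertices T. \<phi> w = (if w = z then 1 else 0)) \<and>
     (\<forall>x. x \<notin> \<Union>T \<longrightarrow> \<phi> x = 0))"

definition fe_space ::
    "boundary_condition \<Rightarrow> (real^'d) set \<Rightarrow> (real^'d) set set \<Rightarrow> (real^'d \<Rightarrow> real) set" where
  "fe_space bc S T = {u. \<exists>c. u = (\<lambda>x. \<Sum>z\<in>active_vertices bc S T. c z * nodal_basis T z x)}"

definition barycenter :: "(real^'d) set \<Rightarrow> real^'d" where
  "barycenter F = (\<Sum>v | v extreme_point_of F. v) /\<^sub>R real (card {v. v extreme_point_of F})"

definition dual_piece :: "real^'d \<Rightarrow> (real^'d) set \<Rightarrow> (real^'d) set" where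
  "dual_piece z K = convex hull {barycenter F | F. F face_of K \<and> z \<in> F}"

definition dual_cell :: "(real^'d) set set \<Rightarrow> real^'d \<Rightarrow> (real^'d) set" where
  "dual_cell T z = (\<Union>K\<in>{K \<in> T. z extreme_point_of K}. dual_piece z K)"

definition dual_space ::
    "boundary_condition \<Rightarrow> (real^'d) set \<Rightarrow> (real^'d) set set \<Rightarrow> (real^'d \<Rightarrow> real) set" where
  "dual_space bc S T =
     {w. \<exists>c. w = (\<lambda>x. \<Sum>z\<in>active_vertices bc S T. c z * indicat_real (dual_cell T z) x)}"

definition lump ::
    "boundary_condition \<Rightarrow> (real^'d) set \<Rightarrow> (real^'d) set set \<Rightarrow> (real^'d \<Rightarrow> real) \<Rightarrow> real^'d \<Rightarrow> real" where
  "lump bc S T u = (\<lambda>x. \<Sum>z\<in>active_vertices bc S T. u z * indicat_real (dual_cell T z) x)"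

definition lump_inverse ::
    "boundary_condition \<Rightarrow> (real^'d) set \<Rightarrow> (real^'d) set set \<Rightarrow> (real^'d \<Rightarrow> real) \<Rightarrow> real^'d \<Rightarrow> real" where
  "lump_inverse bc S T w =
     (THE u. u \<in> fe_space bc S T \<and> (AE x in lebesgue_on S. lump bc S T u x = w x))"

definition lumped_inner ::
    "boundary_condition \<Rightarrow> (real^'d) set \<Rightarrow> (real^'d) set set \<Rightarrow>
     (real^'d \<Rightarrow> real) \<Rightarrow> (real^'d \<Rightarrow> real) \<Rightarrow> real" where
  "lumped_inner bc S T u v = L2_inner S (lump bc S T u) (lump bc S T v)"


section \<open>Admissible inner products and bilinear forms\<close>

definition symmetric_bilinear_on ::
    "('a \<Rightarrow> real) set \<Rightarrow> (('a \<Rightarrow> real) \<Rightarrow> ('a \<Rightarrow> real) \<Rightarrow> real) \<Rightarrow> bool" where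
  "symmetric_bilinear_on V b \<longleftrightarrow>
     (\<forall>u\<in>V. \<forall>v\<in>V. b u v = b v u) \<and>
     (\<forall>u\<in>V. \<forall>v\<in>V. \<forall>w\<in>V. b (\<lambda>x. u x + v x) w = b u w + b v w) \<and>
     (\<forall>c. \<forall>u\<in>V. \<forall>w\<in>V. b (\<lambda>x. c * u x) w = c * b u w)"

definition positive_definite_on ::
    "('a \<Rightarrow> real) set \<Rightarrow> (('a \<Rightarrow> real) \<Rightarrow> ('a \<Rightarrow> real) \<Rightarrow> real) \<Rightarrow> bool" where
  "positive_definite_on V b \<longleftrightarrow> (\<forall>u\<in>V. u \<noteq> (\<lambda>x. 0) \<longrightarrow> 0 < b u u)"

definition admissible_inner ::
    "boundary_condition \<Rightarrow> (real^'d) set \<Rightarrow> real set \<Rightarrow> (real \<Rightarrow> (real^'d) set set) \<Rightarrow>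
     (real \<Rightarrow> (real^'d \<Rightarrow> real) \<Rightarrow> (real^'d \<Rightarrow> real) \<Rightarrow> real) \<Rightarrow> bool" where
  "admissible_inner bc S H T ip \<longleftrightarrow>
     (\<forall>h\<in>H. symmetric_bilinear_on (fe_space bc S (T h)) (ip h) \<and>
            positive_definite_on (fe_space bc S (T h)) (ip h)) \<and>
     (\<exists>C. \<forall>h\<in>H. \<forall>u\<in>fe_space bc S (T h). \<forall>v\<in>fe_space bc S (T h).
        \<bar>L2_inner S u v - ip h u v\<bar> \<le> C * h\<^sup>2 * H1_seminorm S u * H1_seminorm S v) \<and>
     (\<exists>c>0. \<exists>C. \<forall>h\<in>H. \<forall>u\<in>fe_space bc S (T h).
        c * L2_norm S u \<le> sqrt (ip h u u) \<and> sqrt (ip h u u) \<le> C * L2_norm S u)"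

definition admissible_form ::
    "boundary_condition \<Rightarrow> (real^'d) set \<Rightarrow> (real^'d \<Rightarrow> real^'d^'d) \<Rightarrow> (real^'d \<Rightarrow> real) \<Rightarrow>
     real set \<Rightarrow> (real \<Rightarrow> (real^'d) set set) \<Rightarrow>
     (real \<Rightarrow> (real^'d \<Rightarrow> real) \<Rightarrow> (real^'d \<Rightarrow> real) \<Rightarrow> real) \<Rightarrow> bool" where
  "admissible_form bc S A \<kappa> H T a \<longleftrightarrow>
     (\<forall>h\<in>H. symmetric_bilinear_on (fe_space bc S (T h)) (a h)) \<and>
     (\<forall>h\<in>H. \<exists>C. \<forall>u\<in>fe_space bc S (T h). \<forall>v\<in>fe_space bc S (T h).
        \<bar>a h u v\<bar> \<le> C * H1_norm S u * H1_norm S v) \<and>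
     (\<exists>C. \<forall>h\<in>H. \<forall>u\<in>fe_space bc S (T h). \<forall>v\<in>fe_space bc S (T h).
        \<bar>energy_form S A \<kappa> u v - a h u v\<bar> \<le> C * h\<^sup>2 * H1_seminorm S u * H1_seminorm S v)"


section \<open>Discrete operators\<close>

definition discrete_L ::
    "('a \<Rightarrow> real) set \<Rightarrow> (('a \<Rightarrow> real) \<Rightarrow> ('a \<Rightarrow> real) \<Rightarrow> real) \<Rightarrow>
     (('a \<Rightarrow> real) \<Rightarrow> ('a \<Rightarrow> real) \<Rightarrow> real) \<Rightarrow> ('a \<Rightarrow> real) \<Rightarrow> 'a \<Rightarrow> real" where
  "discrete_L V ip a u = (THE w. w \<in> V \<and> (\<forall>v\<in>V. ip w v = a u v))"

definition discrete_P ::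
    "boundary_condition \<Rightarrow> (real^'d) set \<Rightarrow> (real^'d) set set \<Rightarrow>
     ((real^'d \<Rightarrow> real) \<Rightarrow> (real^'d \<Rightarrow> real) \<Rightarrow> real) \<Rightarrow> (real^'d \<Rightarrow> real) \<Rightarrow> real^'d \<Rightarrow> real" where
  "discrete_P bc S T ip f =
     (THE w. w \<in> fe_space bc S T \<and> (\<forall>u\<in>fe_space bc S T. ip w u = L2_inner S f (lump bc S T u)))"

definition discrete_T ::
    "boundary_condition \<Rightarrow> (real^'d) set \<Rightarrow> (real^'d) set set \<Rightarrow>
     ((real^'d \<Rightarrow> real) \<Rightarrow> (real^'d \<Rightarrow> real) \<Rightarrow> real) \<Rightarrow>
     ((real^'d \<Rightarrow> real) \<Rightarrow> (real^'d \<Rightarrow> real) \<Rightarrow> real) \<Rightarrow> (real^'d \<Rightarrow> real) \<Rightarrow> real^'d \<Rightarrow> real" where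
  "discrete_T bc S T ip a f =
     inv_into (fe_space bc S T) (discrete_L (fe_space bc S T) ip a) (discrete_P bc S T ip f)"


section \<open>Spectral calculus\<close>

text \<open>Let \<open>X\<close> be a space of functions with a positive semidefinite inner product \<open>ip\<close>, whose elements are
  identified when they differ by an element of norm \<open>0\<close>: for \<open>L\<^sup>2(S)\<close> this is equality almost everywhere
  on \<open>S\<close>, and if \<open>ip\<close> is definite on \<open>X\<close> it is equality. For a selfadjoint \<open>B\<close> whose spectrum consists of
  finitely many eigenvalues (an operator on a finite-dimensional space, or one of finite rank, where
  \<open>0\<close> may be an eigenvalue of infinite multiplicity), \<open>spectral_fun X ip f B\<close> is the operator
  \<open>f(B) = \<Sum>\<^bsub>l\<^esub> f(l) E\<^bsub>l\<^esub>\<close>, with \<open>l\<close> running over the eigenvalues and \<open>E\<^bsub>l\<^esub>\<close> the orthogonal projection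
  onto the eigenspace of \<open>l\<close>.\<close>

definition ip_eq ::
    "(('a \<Rightarrow> real) \<Rightarrow> ('a \<Rightarrow> real) \<Rightarrow> real) \<Rightarrow> ('a \<Rightarrow> real) \<Rightarrow> ('a \<Rightarrow> real) \<Rightarrow> bool" where
  "ip_eq ip u v \<longleftrightarrow> ip (\<lambda>x. u x - v x) (\<lambda>x. u x - v x) = 0"

definition eigen_space ::
    "('a \<Rightarrow> real) set \<Rightarrow> (('a \<Rightarrow> real) \<Rightarrow> ('a \<Rightarrow> real) \<Rightarrow> real) \<Rightarrow>
     (('a \<Rightarrow> real) \<Rightarrow> 'a \<Rightarrow> real) \<Rightarrow> real \<Rightarrow> ('a \<Rightarrow> real) set" where
  "eigen_space X ip B l = {u \<in> X. ip_eq ip (B u) (\<lambda>x. l * u x)}"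

definition eigen_values ::
    "('a \<Rightarrow> real) set \<Rightarrow> (('a \<Rightarrow> real) \<Rightarrow> ('a \<Rightarrow> real) \<Rightarrow> real) \<Rightarrow>
     (('a \<Rightarrow> real) \<Rightarrow> 'a \<Rightarrow> real) \<Rightarrow> real set" where
  "eigen_values X ip B = {l. \<exists>u\<in>eigen_space X ip B l. \<not> ip_eq ip u (\<lambda>x. 0)}"

definition orth_projection ::
    "(('a \<Rightarrow> real) \<Rightarrow> ('a \<Rightarrow> real) \<Rightarrow> real) \<Rightarrow> ('a \<Rightarrow> real) set \<Rightarrow> ('a \<Rightarrow> real) \<Rightarrow> 'a \<Rightarrow> real" where
  "orth_projection ip U v = (SOME u. u \<in> U \<and> (\<forall>w\<in>U. ip (\<lambda>x. v x - u x) w = 0))"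

definition spectral_fun ::
    "('a \<Rightarrow> real) set \<Rightarrow> (('a \<Rightarrow> real) \<Rightarrow> ('a \<Rightarrow> real) \<Rightarrow> real) \<Rightarrow> (real \<Rightarrow> real) \<Rightarrow>
     (('a \<Rightarrow> real) \<Rightarrow> 'a \<Rightarrow> real) \<Rightarrow> ('a \<Rightarrow> real) \<Rightarrow> 'a \<Rightarrow> real" where
  "spectral_fun X ip f B v =
     (\<lambda>x. \<Sum>l\<in>eigen_values X ip B. f l * orth_projection ip (eigen_space X ip B l) v x)"

text \<open>\<open>T\<^sup>Q\<^bsub>h,\<beta>\<^esub> = (L\<^bsub>h,Q\<^esub>)\<^bsup>-\<beta>\<^esup> P\<^bsub>h,Q\<^esub>\<close>\<close>

definition fractional_TQ ::
    "boundary_condition \<Rightarrow> (real^'d) set \<Rightarrow> (real^'d) set set \<Rightarrow>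
     ((real^'d \<Rightarrow> real) \<Rightarrow> (real^'d \<Rightarrow> real) \<Rightarrow> real) \<Rightarrow> real \<Rightarrow> (real^'d \<Rightarrow> real) \<Rightarrow> real^'d \<Rightarrow> real" where
  "fractional_TQ bc S T a \<beta> f =
     spectral_fun (fe_space bc S T) (lumped_inner bc S T) (\<lambda>l. l powr (- \<beta>))
       (discrete_L (fe_space bc S T) (lumped_inner bc S T) a)
       (discrete_P bc S T (lumped_inner bc S T) f)"

text \<open>The power \<open>B\<^bsup>\<beta>\<^esup>\<close> on \<open>L\<^sup>2(S)\<close>; the convention \<open>0\<^bsup>\<beta>\<^esup> = 0\<close> is that of \<open>powr\<close>.\<close>

definition L2_power ::
    "(real^'d) set \<Rightarrow> ((real^'d \<Rightarrow> real) \<Rightarrow> real^'d \<Rightarrow> real) \<Rightarrow> real \<Rightarrow> (real^'d \<Rightarrow> real) \<Rightarrow> real^'d \<Rightarrow> real" where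
  "L2_power S B \<beta> = spectral_fun (L2_space S) (L2_inner S) (\<lambda>l. l powr \<beta>) B"

end

theory Submission
  imports Defs "HOL-Library.Function_Algebras"
begin

text \<open>For every auxiliary inner product, \<open>T\<^sub>h f\<close> is the element of \<open>V\<^sub>h\<close> with
  \<open>a\<^sub>h(T\<^sub>h f, v) = (f, Q v)\<close> for all \<open>v\<close>. Hence \<open>f\<close> is an eigenfunction of \<open>Q T\<^sub>h\<close> for \<open>m \<noteq> 0\<close> exactly
  when \<open>f = Q u\<close> with \<open>a\<^sub>h(u, v) = m\<^sup>-\<^sup>1 (Q u, Q v)\<close> for all \<open>v\<close>, that is, with \<open>u\<close> an eigenvector of
  \<open>L\<^bsub>h,Q\<^esub>\<close> for \<open>1 / m\<close>. As \<open>P\<^bsub>h,Q\<^esub>\<close> is the adjoint of \<open>Q\<close>, the orthogonal projection of \<open>f\<close> onto the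
  eigenspace of \<open>Q T\<^sub>h\<close> is \<open>Q\<close> applied to the projection of \<open>P\<^bsub>h,Q\<^esub> f\<close> onto that of \<open>L\<^bsub>h,Q\<^esub>\<close>, and the
  two spectral sums agree term by term; completeness of the eigenvectors plays no role. Definiteness of
  the lumped inner product holds because near a vertex \<open>z\<close> some open set meets no dual cell but that
  of \<open>z\<close>.\<close>

section \<open>Finite-dimensional inner product spaces of functions\<close>

text \<open>Closure is phrased with explicit pointwise lambda terms, the shape in which
  \<open>symmetric_bilinear_on\<close> presents sums and multiples.\<close>

definition function_subspace :: "('a \<Rightarrow> real) set \<Rightarrow> bool" where
  "function_subspace U \<longleftrightarrow> (\<lambda>x. 0) \<in> U \<and> (\<forall>u\<in>U. \<forall>v\<in>U. (\<lambda>x. u x + v x) \<in> U) \<and>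
     (\<forall>c. \<forall>u\<in>U. (\<lambda>x. c * u x) \<in> U)"

definition linear_functional_on :: "('a \<Rightarrow> real) set \<Rightarrow> (('a \<Rightarrow> real) \<Rightarrow> real) \<Rightarrow> bool" where
  "linear_functional_on U l \<longleftrightarrow> (\<forall>u\<in>U. \<forall>v\<in>U. l (\<lambda>x. u x + v x) = l u + l v) \<and>
     (\<forall>c. \<forall>u\<in>U. l (\<lambda>x. c * u x) = c * l u)"

lemma function_subspace_zero: "function_subspace U \<Longrightarrow> (\<lambda>x. 0) \<in> U"
  by (simp add: function_subspace_def)

lemma function_subspace_add:
  "function_subspace U \<Longrightarrow> u \<in> U \<Longrightarrow> v \<in> U \<Longrightarrow> (\<lambda>x. u x + v x) \<in> U"
  by (simp add: function_subspace_def)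

lemma function_subspace_scale: "function_subspace U \<Longrightarrow> u \<in> U \<Longrightarrow> (\<lambda>x. c * u x) \<in> U"
  by (simp add: function_subspace_def)

lemma linear_functional_on_add:
  "linear_functional_on U l \<Longrightarrow> u \<in> U \<Longrightarrow> v \<in> U \<Longrightarrow> l (\<lambda>x. u x + v x) = l u + l v"
  by (simp add: linear_functional_on_def)

lemma linear_functional_on_scale:
  "linear_functional_on U l \<Longrightarrow> u \<in> U \<Longrightarrow> l (\<lambda>x. c * u x) = c * l u"
  by (simp add: linear_functional_on_def)

lemma function_subspace_diff:
  assumes "function_subspace U" "u \<in> U" "v \<in> U"
  shows "(\<lambda>x. u x - v x) \<in> U"
  using function_subspace_add[OF assms(1,2) function_subspace_scale[OF assms(1,3), of "-1"]]
  by simp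

lemma function_subspace_sum:
  assumes "function_subspace U" "finite B" "\<And>b. b \<in> B \<Longrightarrow> g b \<in> U"
  shows "(\<lambda>x. \<Sum>b\<in>B. c b * g b x) \<in> U"
  using assms(2,3)
proof (induction B)
  case empty
  then show ?case using function_subspace_zero[OF assms(1)] by simp
next
  case (insert b B)
  then have "(\<lambda>x. c b * g b x + (\<Sum>b\<in>B. c b * g b x)) \<in> U"
    by (intro function_subspace_add[OF assms(1)] function_subspace_scale[OF assms(1)]) auto
  then show ?case using insert by simp
qed

lemma linear_functional_on_sum:
  assumes "function_subspace U" "linear_functional_on U l" "finite B" "\<And>b. b \<in> B \<Longrightarrow> g b \<in> U"
  shows "l (\<lambda>x. \<Sum>b\<in>B. c b * g b x) = (\<Sum>b\<in>B. c b * l (g b))"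
  using assms(3,4)
proof (induction B)
  case empty
  \<comment> \<open>The empty sum is 0 times the zero function, so homogeneity with factor 0 gives
    the value 0.\<close>
  show ?case
    using linear_functional_on_scale[OF assms(2) function_subspace_zero[OF assms(1)], of 0] by simp
next
  case (insert b B)
  have "(\<lambda>x. \<Sum>b\<in>B. c b * g b x) \<in> U"
    using insert by (intro function_subspace_sum[OF assms(1)]) auto
  then have "l (\<lambda>x. c b * g b x + (\<Sum>b\<in>B. c b * g b x)) =
      l (\<lambda>x. c b * g b x) + l (\<lambda>x. \<Sum>b\<in>B. c b * g b x)"
    using insert by (intro linear_functional_on_add[OF assms(2)] function_subspace_scale[OF assms(1)]) auto
  then show ?case using insert linear_functional_on_scale[OF assms(2), of "g b"] by simp
qed

lemma linear_functional_on_diff: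
  assumes "function_subspace U" "linear_functional_on U l" "u \<in> U" "v \<in> U"
  shows "l (\<lambda>x. u x - v x) = l u - l v"
  using linear_functional_on_add[OF assms(2,3) function_subspace_scale[OF assms(1,4), of "-1"]]
    linear_functional_on_scale[OF assms(2,4), of "-1"] by simp

lemma linear_functional_on_subset:
  "linear_functional_on V l \<Longrightarrow> U \<subseteq> V \<Longrightarrow> linear_functional_on U l"
  unfolding linear_functional_on_def by blast

section \<open>Finitely spanned function spaces with a definite inner product\<close>

definition function_span :: "'i set \<Rightarrow> ('i \<Rightarrow> 'a \<Rightarrow> real) \<Rightarrow> ('a \<Rightarrow> real) set" where
  "function_span Z \<phi> = {u. \<exists>c. u = (\<lambda>x. \<Sum>z\<in>Z. c z * \<phi> z x)}"

lemma function_subspace_span: "function_subspace (function_span Z \<phi>)"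
  unfolding function_subspace_def
proof (intro conjI ballI allI)
  show "(\<lambda>x. 0) \<in> function_span Z \<phi>"
    unfolding function_span_def by (intro CollectI exI[of _ "\<lambda>_. 0"]) simp
next
  fix u v assume "u \<in> function_span Z \<phi>" "v \<in> function_span Z \<phi>"
  then obtain c d where "u = (\<lambda>x. \<Sum>z\<in>Z. c z * \<phi> z x)" "v = (\<lambda>x. \<Sum>z\<in>Z. d z * \<phi> z x)"
    unfolding function_span_def by blast
  then show "(\<lambda>x. u x + v x) \<in> function_span Z \<phi>"
    unfolding function_span_def
    by (intro CollectI exI[of _ "\<lambda>z. c z + d z"]) (simp add: sum.distrib algebra_simps)
next
  fix k u assume "u \<in> function_span Z \<phi>"
  then obtain c where "u = (\<lambda>x. \<Sum>z\<in>Z. c z * \<phi> z x)"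
    unfolding function_span_def by blast
  then show "(\<lambda>x. k * u x) \<in> function_span Z \<phi>"
    unfolding function_span_def
    by (intro CollectI exI[of _ "\<lambda>z. k * c z"]) (simp add: sum_distrib_left algebra_simps)
qed

text \<open>Dimension enters through a finite spanning family, whose cardinality bounds every
  orthonormal set.\<close>

locale finite_dimensional_inner_product =
  fixes Z :: "'i set" and \<phi> :: "'i \<Rightarrow> 'a \<Rightarrow> real" and V :: "('a \<Rightarrow> real) set"
    and ip :: "('a \<Rightarrow> real) \<Rightarrow> ('a \<Rightarrow> real) \<Rightarrow> real"
  assumes finite_Z: "finite Z"
    and V_eq: "V = function_span Z \<phi>"
    and symmetric_bilinear: "symmetric_bilinear_on V ip"
    and positive_definite: "positive_definite_on V ip"
begin

lemma subspace_V: "function_subspace V"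
  by (simp add: V_eq function_subspace_span)

lemma ip_commute: "u \<in> V \<Longrightarrow> v \<in> V \<Longrightarrow> ip u v = ip v u"
  using symmetric_bilinear unfolding symmetric_bilinear_on_def by blast

lemma linear_ip_left: "w \<in> V \<Longrightarrow> linear_functional_on V (\<lambda>u. ip u w)"
  using symmetric_bilinear unfolding symmetric_bilinear_on_def linear_functional_on_def by blast

text \<open>\<open>symmetric_bilinear_on\<close> records linearity in the first argument; symmetry
  carries it over to the second, since \<open>V\<close> is closed under the operations
  involved.\<close>

lemma linear_ip_right:
  assumes "w \<in> V" shows "linear_functional_on V (ip w)"
proof -
  have "linear_functional_on V (ip w) \<longleftrightarrow> linear_functional_on V (\<lambda>u. ip u w)"
    using subspace_V assms ip_commute unfolding linear_functional_on_def function_subspace_def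
    by simp
  then show ?thesis using linear_ip_left[OF assms] by simp
qed

lemma ip_diff_left: "u \<in> V \<Longrightarrow> v \<in> V \<Longrightarrow> w \<in> V \<Longrightarrow> ip (\<lambda>x. u x - v x) w = ip u w - ip v w"
  using linear_functional_on_diff[OF subspace_V linear_ip_left] by blast

lemma ip_zero_left: "w \<in> V \<Longrightarrow> ip (\<lambda>x. 0) w = 0"
  using linear_functional_on_sum[OF subspace_V linear_ip_left, of w "{}"] by simp

lemma ip_self_eq_0: "u \<in> V \<Longrightarrow> ip u u = 0 \<Longrightarrow> u = (\<lambda>x. 0)"
  using positive_definite unfolding positive_definite_on_def by force

text \<open>Definiteness turns the identification modulo null vectors built into the spectral
  calculus into ordinary equality on \<open>V\<close>.\<close>

lemma ip_eq_iff:
  assumes "u \<in> V" "v \<in> V"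
  shows "ip_eq ip u v \<longleftrightarrow> u = v"
proof
  assume "ip_eq ip u v"
  then have "(\<lambda>x. u x - v x) = (\<lambda>x. 0)"
    using ip_self_eq_0 function_subspace_diff[OF subspace_V] assms unfolding ip_eq_def by blast
  then show "u = v" by (simp add: fun_eq_iff)
next
  assume "u = v"
  then show "ip_eq ip u v"
    using ip_zero_left subspace_V unfolding ip_eq_def function_subspace_def by simp
qed

text \<open>Testing with the difference of \<open>u\<close> and \<open>w\<close>, itself in
  \<open>U\<close>, makes that difference orthogonal to itself. This is the uniqueness half of Riesz
  representation.\<close>

lemma ip_cancel:
  assumes U: "function_subspace U" "U \<subseteq> V" and "u \<in> U" "w \<in> U"
    and "\<And>v. v \<in> U \<Longrightarrow> ip u v = ip w v"
  shows "u = w"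
proof -
  have d: "(\<lambda>x. u x - w x) \<in> U"
    using assms function_subspace_diff by blast
  then have "ip (\<lambda>x. u x - w x) (\<lambda>x. u x - w x) = 0"
    using assms ip_diff_left by (simp add: subset_iff)
  then have "ip_eq ip u w" by (simp add: ip_eq_def)
  then show ?thesis using ip_eq_iff assms by blast
qed

text \<open>Orthonormal vectors are linearly independent, and an independent set in the span of
  \<open>card Z\<close> vectors has at most that many elements.\<close>

lemma orthonormal_card_le:
  assumes "B \<subseteq> V" "\<And>b c. b \<in> B \<Longrightarrow> c \<in> B \<Longrightarrow> ip b c = (if b = c then 1 else 0)"
  shows "finite B \<and> card B \<le> card Z"
proof -
  interpret fn: vector_space "\<lambda>(c::real) (f::'a \<Rightarrow> real) x. c * f x"
    by standard (auto simp: fun_eq_iff algebra_simps)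
  \<comment> \<open>Linear algebra on the function type uses its additive structure; this translates
    its sums into the pointwise lambda terms used elsewhere.\<close>
  have sum_apply: "(\<Sum>i\<in>I. f i) = (\<lambda>x. \<Sum>i\<in>I. f i x)" for I and f :: "_ \<Rightarrow> 'a \<Rightarrow> real"
    by (induction I rule: infinite_finite_induct) (auto simp: fun_eq_iff)
  have "fn.independent B"
    unfolding fn.independent_explicit_module
  proof (intro allI impI)
    fix t u v
    assume t: "finite t" "t \<subseteq> B" "(\<Sum>v\<in>t. (\<lambda>x. u v * v x)) = 0" "v \<in> t"
    have tV: "t \<subseteq> V" using t assms by blast
    have "(\<lambda>x. \<Sum>b\<in>t. u b * b x) = (\<lambda>x. 0)"
      using t(3) by (simp add: sum_apply zero_fun_def)
    \<comment> \<open>Pairing the vanishing combination with \<open>v\<close> isolates the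
      coefficient of \<open>v\<close>.\<close>
    then have "(\<Sum>b\<in>t. u b * ip b v) = 0"
      using linear_functional_on_sum[OF subspace_V linear_ip_left[of v] t(1), of "\<lambda>b. b" u]
        tV t(4) ip_zero_left[of v] by auto
    moreover have "(\<Sum>b\<in>t. u b * ip b v) = (\<Sum>b\<in>t. if b = v then u b else 0)"
      using t assms(2) by (intro sum.cong) (auto simp: subset_iff)
    ultimately show "u v = 0" using t by simp
  qed
  moreover have "B \<subseteq> fn.span (\<phi> ` Z)"
  proof
    fix b assume "b \<in> B"
    then obtain c where "b = (\<lambda>x. \<Sum>z\<in>Z. c z * \<phi> z x)"
      using assms V_eq unfolding function_span_def by blast
    then have "b = (\<Sum>z\<in>Z. (\<lambda>x. c z * \<phi> z x))" by (simp add: sum_apply)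
    then show "b \<in> fn.span (\<phi> ` Z)"
      by (auto intro: fn.span_sum fn.span_scale fn.span_base)
  qed
  ultimately have "finite B \<and> card B \<le> card (\<phi> ` Z)"
    using fn.independent_span_bound finite_Z by blast
  then show ?thesis using card_image_le[OF finite_Z, of \<phi>] by linarith
qed

lemma ip_pos: "u \<in> V \<Longrightarrow> u \<noteq> (\<lambda>x. 0) \<Longrightarrow> 0 < ip u u"
  using positive_definite unfolding positive_definite_on_def by blast

lemma ip_scale:
  assumes "u \<in> V" "v \<in> V"
  shows "ip (\<lambda>x. c * u x) v = c * ip u v" "ip u (\<lambda>x. c * v x) = c * ip u v"
  using linear_functional_on_scale[OF linear_ip_left[OF assms(2)] assms(1)]
    linear_functional_on_scale[OF linear_ip_right[OF assms(1)] assms(2)] by auto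

lemma normalize:
  assumes "u \<in> V" "u \<noteq> (\<lambda>x. 0)"
  defines "e \<equiv> \<lambda>x. (1 / sqrt (ip u u)) * u x"
  shows "e \<in> V" "ip e e = 1"
proof -
  show eV: "e \<in> V" unfolding e_def by (rule function_subspace_scale[OF subspace_V assms(1)])
  have "ip e e = (1 / sqrt (ip u u)) * ip u e"
    using ip_scale(1)[OF assms(1) eV, of "1 / sqrt (ip u u)"] by (simp add: e_def)
  also have "ip u e = (1 / sqrt (ip u u)) * ip u u"
    using ip_scale(2)[OF assms(1) assms(1), of "1 / sqrt (ip u u)"] by (simp add: e_def)
  finally have "ip e e = (1 / sqrt (ip u u)) * ((1 / sqrt (ip u u)) * ip u u)" .
  then show "ip e e = 1" using ip_pos[OF assms(1,2)] by simp
qed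

text \<open>An orthonormal subset of \<open>U\<close> of maximal cardinality spans \<open>U\<close>.\<close>

lemma riesz:
  assumes U: "function_subspace U" "U \<subseteq> V" and l: "linear_functional_on U l"
  shows "\<exists>w\<in>U. \<forall>u\<in>U. ip w u = l u"
proof -
  define ON where "ON B \<longleftrightarrow> B \<subseteq> U \<and> (\<forall>b\<in>B. \<forall>c\<in>B. ip b c = (if b = c then 1 else 0))" for B
  have bound: "finite B \<and> card B \<le> card Z" if "ON B" for B
    using that orthonormal_card_le[of B] U unfolding ON_def by blast
  have "ON {}" by (simp add: ON_def)
  \<comment> \<open>The maximum principle asks for a strict upper bound on the cardinalities, hence
    \<open>Suc\<close>.\<close>
  then obtain B where B: "ON B" and max: "\<And>B'. ON B' \<Longrightarrow> card B' \<le> card B"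
    using ex_has_greatest_nat[of ON "{}" card "Suc (card Z)"] bound by (metis less_Suc_eq_le)
  have fin: "finite B" using bound B by blast
  have BU: "b \<in> U" "b \<in> V" if "b \<in> B" for b using B U that unfolding ON_def by auto
  \<comment> \<open>If \<open>u\<close> differed from its Fourier sum over \<open>B\<close>, the
    normalized remainder could be adjoined to \<open>B\<close>, contradicting maximality.\<close>
  have expand: "u = (\<lambda>x. \<Sum>b\<in>B. ip u b * b x)" if "u \<in> U" for u
  proof (rule ccontr)
    assume ne: "u \<noteq> (\<lambda>x. \<Sum>b\<in>B. ip u b * b x)"
    define s where "s = (\<lambda>x. \<Sum>b\<in>B. ip u b * b x)"
    define d where "d = (\<lambda>x. u x - s x)"
    have sU: "s \<in> U" unfolding s_def by (rule function_subspace_sum[OF U(1) fin]) (rule BU(1))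
    have dU: "d \<in> U" unfolding d_def using function_subspace_diff[OF U(1) \<open>u \<in> U\<close> sU] .
    have dV: "d \<in> V" and uV: "u \<in> V" and sV: "s \<in> V" using dU sU \<open>u \<in> U\<close> U by auto
    have d0: "d \<noteq> (\<lambda>x. 0)" using ne unfolding d_def s_def by (auto simp: fun_eq_iff)
    have orth: "ip d b = 0" if "b \<in> B" for b
    proof -
      have "ip s b = (\<Sum>c\<in>B. ip u c * ip c b)"
        unfolding s_def
        by (rule linear_functional_on_sum[OF subspace_V linear_ip_left[OF BU(2)[OF that]] fin]) (rule BU(2))
      also have "\<dots> = (\<Sum>c\<in>B. if c = b then ip u c else 0)"
        using B that by (intro sum.cong) (auto simp: ON_def)
      also have "\<dots> = ip u b" using fin that by simp
      finally show ?thesis unfolding d_def using ip_diff_left uV sV BU that by simp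
    qed
    define e where "e = (\<lambda>x. (1 / sqrt (ip d d)) * d x)"
    have eV: "e \<in> V" and ee: "ip e e = 1" using normalize[OF dV d0] by (simp_all add: e_def)
    have eU: "e \<in> U" unfolding e_def by (rule function_subspace_scale[OF U(1) dU])
    have eo: "ip e b = 0" "ip b e = 0" if "b \<in> B" for b
    proof -
      show "ip e b = 0"
        unfolding e_def by (subst ip_scale(1)[OF dV BU(2)[OF that]]) (simp add: orth[OF that])
      then show "ip b e = 0" using ip_commute[OF eV BU(2)[OF that]] by simp
    qed
    have "e \<notin> B" using eo ee by force
    have "ON (insert e B)"
      using B eU ee eo \<open>e \<notin> B\<close> unfolding ON_def by auto
    then have "card (insert e B) \<le> card B" by (rule max)
    then show False using fin \<open>e \<notin> B\<close> by simp
  qed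
  \<comment> \<open>The Fourier coefficients of a representer of \<open>l\<close> are forced to be
    the values \<open>l b\<close>.\<close>
  define w where "w = (\<lambda>x. \<Sum>b\<in>B. l b * b x)"
  have wU: "w \<in> U" unfolding w_def by (rule function_subspace_sum[OF U(1) fin]) (rule BU(1))
  moreover have "ip w u = l u" if "u \<in> U" for u
  proof -
    have uV: "u \<in> V" using that U by blast
    have "ip w u = (\<Sum>b\<in>B. l b * ip b u)"
      unfolding w_def
      by (rule linear_functional_on_sum[OF subspace_V linear_ip_left[OF uV] fin]) (rule BU(2))
    also have "\<dots> = (\<Sum>b\<in>B. ip u b * l b)"
      using BU uV ip_commute by (intro sum.cong) auto
    also have "\<dots> = l (\<lambda>x. \<Sum>b\<in>B. ip u b * b x)"
      by (rule linear_functional_on_sum[OF U(1) l fin, symmetric]) (rule BU(1))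
    also have "\<dots> = l u" using expand[OF that] by simp
    finally show ?thesis .
  qed
  ultimately show ?thesis by blast
qed

text \<open>Existence from \<open>riesz\<close> and uniqueness from \<open>ip_cancel\<close> resolve
  the definite descriptions in \<open>discrete_L\<close> and \<open>discrete_P\<close>.\<close>

lemma riesz_the:
  assumes l: "linear_functional_on V l"
  defines "w \<equiv> THE w. w \<in> V \<and> (\<forall>u\<in>V. ip w u = l u)"
  shows "w \<in> V" "\<And>u. u \<in> V \<Longrightarrow> ip w u = l u"
proof -
  have "\<exists>!w. w \<in> V \<and> (\<forall>u\<in>V. ip w u = l u)"
    using riesz[OF subspace_V order_refl l] ip_cancel[OF subspace_V order_refl] by metis
  then have "w \<in> V \<and> (\<forall>u\<in>V. ip w u = l u)" unfolding w_def by (rule theI')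
  then show "w \<in> V" "\<And>u. u \<in> V \<Longrightarrow> ip w u = l u" by auto
qed

text \<open>\<open>orth_projection\<close> is an arbitrary choice, but definiteness on
  \<open>U\<close> leaves only one candidate.\<close>

lemma orth_projection_eqI:
  assumes U: "function_subspace U" "U \<subseteq> V" and "v \<in> V" "u \<in> U"
    and "\<And>w. w \<in> U \<Longrightarrow> ip u w = ip v w"
  shows "orth_projection ip U v = u"
  unfolding orth_projection_def
proof (rule some_equality)
  show "u \<in> U \<and> (\<forall>w\<in>U. ip (\<lambda>x. v x - u x) w = 0)"
    using assms ip_diff_left by (simp add: subset_iff)
next
  fix u' assume u': "u' \<in> U \<and> (\<forall>w\<in>U. ip (\<lambda>x. v x - u' x) w = 0)"
  then have "ip u' w = ip u w" if "w \<in> U" for w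
    using that assms ip_diff_left[of v u' w] by (auto simp: subset_iff)
  then show "u' = u" using ip_cancel[OF U] u' assms by blast
qed

text \<open>The projection of \<open>v\<close> is the Riesz representer in \<open>U\<close> of the
  functional \<open>ip v\<close>.\<close>

lemma orth_projection:
  assumes U: "function_subspace U" "U \<subseteq> V" and "v \<in> V"
  shows "orth_projection ip U v \<in> U" "\<And>w. w \<in> U \<Longrightarrow> ip (orth_projection ip U v) w = ip v w"
proof -
  have "linear_functional_on U (ip v)"
    using linear_functional_on_subset[OF linear_ip_right] assms by blast
  then obtain u where "u \<in> U" "\<And>w. w \<in> U \<Longrightarrow> ip u w = ip v w" using riesz[OF U] by blast
  moreover from this have "orth_projection ip U v = u" using orth_projection_eqI assms by blast
  ultimately show "orth_projection ip U v \<in> U"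
    "\<And>w. w \<in> U \<Longrightarrow> ip (orth_projection ip U v) w = ip v w" by auto
qed

text \<open>By symmetry of both forms, eigenvectors for different eigenvalues are orthogonal. One
  normalized eigenvector per eigenvalue yields an orthonormal set, whose size is bounded.\<close>

lemma finite_generalized_eigenvalues:
  assumes a: "\<And>u v. u \<in> V \<Longrightarrow> v \<in> V \<Longrightarrow> a u v = a v u"
  shows "finite {l. \<exists>u\<in>V. u \<noteq> (\<lambda>x. 0) \<and> (\<forall>v\<in>V. a u v = l * ip u v)}" (is "finite ?E")
proof -
  have "\<forall>l\<in>?E. \<exists>u. u \<in> V \<and> u \<noteq> (\<lambda>x. 0) \<and> (\<forall>v\<in>V. a u v = l * ip u v)" by blast
  then obtain g where g: "\<And>l. l \<in> ?E \<Longrightarrow> g l \<in> V" "\<And>l. l \<in> ?E \<Longrightarrow> g l \<noteq> (\<lambda>x. 0)"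
    "\<And>l v. l \<in> ?E \<Longrightarrow> v \<in> V \<Longrightarrow> a (g l) v = l * ip (g l) v"
    unfolding bchoice_iff by blast
  define e where "e l = (\<lambda>x. (1 / sqrt (ip (g l) (g l))) * g l x)" for l
  have e: "e l \<in> V" "ip (e l) (e l) = 1" if "l \<in> ?E" for l
    using normalize[OF g(1,2)[OF that]] by (simp_all add: e_def)
  have orth: "ip (e l) (e m) = 0" if "l \<in> ?E" "m \<in> ?E" "l \<noteq> m" for l m
  proof -
    have "l * ip (g l) (g m) = m * ip (g l) (g m)"
      using a[OF g(1)[OF that(1)] g(1)[OF that(2)]] g(3)[OF that(1) g(1)[OF that(2)]]
        g(3)[OF that(2) g(1)[OF that(1)]] ip_commute[OF g(1)[OF that(1)] g(1)[OF that(2)]] by simp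
    then have 0: "ip (g l) (g m) = 0" using that(3) by simp
    have "ip (g l) (e m) = 0"
      unfolding e_def by (subst ip_scale(2)[OF g(1)[OF that(1)] g(1)[OF that(2)]]) (simp add: 0)
    then show ?thesis
      unfolding e_def[of l] by (subst ip_scale(1)[OF g(1)[OF that(1)] e(1)[OF that(2)]]) simp
  qed
  \<comment> \<open>Equal vectors for different eigenvalues would be orthogonal to themselves and
    yet have norm 1.\<close>
  have "inj_on e ?E" using orth e(2) by (metis (no_types, lifting) inj_onI zero_neq_one)
  moreover have "finite (e ` ?E)"
    using orthonormal_card_le[of "e ` ?E"] e orth by (smt (verit) image_iff image_subsetI)
  ultimately show ?thesis using finite_imageD by blast
qed

end

section \<open>Simplicial meshes and their dual cells\<close>

text \<open>Moving one point \<open>z\<close> of \<open>C\<close> to the origin turns affine into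
  linear independence. The prescribed increments then extend to a linear functional, and the
  constant term restores the value at \<open>z\<close>.\<close>

lemma affine_interpolation:
  fixes C :: "'a::euclidean_space set" and f :: "'a \<Rightarrow> real"
  assumes "\<not> affine_dependent C"
  shows "\<exists>a b. \<forall>v\<in>C. a \<bullet> v + b = f v"
proof (cases "C = {}")
  case False
  then obtain z where z: "z \<in> C" by blast
  then have "independent ((\<lambda>x. - z + x) ` (C - {z}))"
    using assms affine_dependent_iff_dependent2 by blast
  then obtain g where g: "linear g"
    "\<forall>y \<in> (\<lambda>x. - z + x) ` (C - {z}). g y = f (z + y) - f z"
    using linear_independent_extend[of _ "\<lambda>y. f (z + y) - f z"] by blast
  \<comment> \<open>This vector represents the functional \<open>g\<close> through the Euclidean
    inner product.\<close>
  define a where "a = (\<Sum>b\<in>Basis. g b *\<^sub>R b)"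
  have ga: "g y = a \<bullet> y" for y
  proof -
    have "g y = g (\<Sum>b\<in>Basis. (y \<bullet> b) *\<^sub>R b)" by (simp add: euclidean_representation)
    also have "\<dots> = (\<Sum>b\<in>Basis. (y \<bullet> b) * g b)"
      by (simp add: linear_sum[OF g(1)] linear_cmul[OF g(1)])
    also have "\<dots> = a \<bullet> y"
      by (simp add: a_def inner_sum_left inner_commute[of y] mult.commute)
    finally show ?thesis .
  qed
  have "a \<bullet> v + (f z - a \<bullet> z) = f v" if "v \<in> C" for v
  proof (cases "v = z")
    case False
    then have "g (- z + v) = f v - f z" using g(2) that by force
    then show ?thesis by (simp add: ga inner_diff_right)
  qed simp
  then show ?thesis by blast
qed simp

lemma affine_le_on_hull:
  fixes a :: "'a::euclidean_space"
  assumes "\<And>v. v \<in> C \<Longrightarrow> a \<bullet> v + b \<le> t" "x \<in> convex hull C"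
  shows "a \<bullet> x + b \<le> t"
proof -
  have "convex hull C \<subseteq> {x. a \<bullet> x \<le> t - b}"
    using assms(1) by (intro hull_minimal convex_halfspace_le) (auto simp: algebra_simps)
  then show ?thesis using assms(2) by auto
qed

lemma affine_eq_on_hull:
  fixes a :: "'a::euclidean_space"
  assumes "\<And>v. v \<in> C \<Longrightarrow> a \<bullet> v + b = a' \<bullet> v + b'" "x \<in> convex hull C"
  shows "a \<bullet> x + b = a' \<bullet> x + b'"
proof -
  have "convex hull C \<subseteq> {x. (a - a') \<bullet> x = b' - b}"
    using assms(1) by (intro hull_minimal convex_hyperplane) (auto simp: inner_diff_left algebra_simps)
  then show ?thesis using assms(2) by (auto simp: inner_diff_left)
qed

text \<open>The vertex set whose existence \<open>simplex\<close> asserts is recovered canonically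
  from the extreme points, the form in which the mesh definitions refer to vertices.\<close>

lemma simplex_extreme_points:
  fixes K :: "'a::euclidean_space set"
  assumes "n simplex K"
  defines "C \<equiv> {v. v extreme_point_of K}"
  shows "\<not> affine_dependent C" "K = convex hull C" "int (card C) = n + 1" "finite C"
proof -
  obtain D where D: "\<not> affine_dependent D" "int (card D) = n + 1" "K = convex hull D"
    using assms(1) unfolding simplex_def by blast
  have "C = D"
    using D extreme_point_of_convex_hull_affine_independent unfolding C_def by blast
  then show "\<not> affine_dependent C" "K = convex hull C" "int (card C) = n + 1" "finite C"
    using D aff_independent_finite by auto
qed

lemma simplex_face_iff:
  fixes K :: "'a::euclidean_space set"
  assumes "n simplex K"
  shows "F face_of K \<longleftrightarrow> (\<exists>c. c \<subseteq> {v. v extreme_point_of K} \<and> F = convex hull c)"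
  using face_of_convex_hull_affine_independent[OF simplex_extreme_points(1)[OF assms], of F]
  unfolding simplex_extreme_points(2)[OF assms, symmetric] .

lemma simplex_face_extreme_points:
  fixes K :: "'a::euclidean_space set"
  assumes "n simplex K" "c \<subseteq> {v. v extreme_point_of K}"
  shows "{v. v extreme_point_of (convex hull c)} = c"
proof -
  have "\<not> affine_dependent c"
    using simplex_extreme_points(1)[OF assms(1)] assms(2) affine_dependent_subset by blast
  then show ?thesis using extreme_point_of_convex_hull_affine_independent[of c] by simp
qed

section \<open>Continuous piecewise affine interpolation and the nodal basis\<close>

lemma finite_mesh_vertices:
  assumes "triangulation T" shows "finite (mesh_vertices T)"
proof -
  have "mesh_vertices T = (\<Union>K\<in>T. {z. z extreme_point_of K})"
    by (auto simp: mesh_vertices_def)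
  moreover have "finite {z. z extreme_point_of K}" if "K \<in> T" for K
    using assms simplex_extreme_points(4) that unfolding triangulation_def by blast
  ultimately show ?thesis
    using assms unfolding triangulation_def by simp
qed

definition piecewise_affine :: "(real^'d) set set \<Rightarrow> (real^'d \<Rightarrow> real) \<Rightarrow> bool" where
  "piecewise_affine T \<phi> \<longleftrightarrow> (\<forall>K\<in>T. \<exists>a b. \<forall>x\<in>K. \<phi> x = a \<bullet> x + b)"

text \<open>Vertex values fix an affine function on each simplex. Two simplices meet in a common
  face spanned by shared vertices, so the local functions agree there and glue. Fixing the value 0
  off the mesh makes uniqueness an equality of functions on the whole space.\<close>

lemma piecewise_affine_interpolation:
  fixes T :: "(real^'d) set set"
  assumes T: "triangulation T"
  shows "\<exists>!\<phi>. continuous_on (\<Union>T) \<phi> \<and> piecewise_affine T \<phi> \<and>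
     (\<forall>w\<in>mesh_vertices T. \<phi> w = f w) \<and> (\<forall>x. x \<notin> \<Union>T \<longrightarrow> \<phi> x = 0)"
proof (rule ex_ex1I)
  have simp: "\<exists>n. n simplex K" if "K \<in> T" for K using T that unfolding triangulation_def by blast
  have "\<forall>K\<in>T. \<exists>p. \<forall>v\<in>{v. v extreme_point_of K}. fst p \<bullet> v + snd p = f v"
  proof
    fix K assume "K \<in> T"
    then obtain n where "n simplex K" using simp by blast
    then obtain a b where "\<forall>v\<in>{v. v extreme_point_of K}. a \<bullet> v + b = f v"
      using affine_interpolation[OF simplex_extreme_points(1), of n K f] by blast
    then show "\<exists>p. \<forall>v\<in>{v. v extreme_point_of K}. fst p \<bullet> v + snd p = f v"
      by (intro exI[of _ "(a, b)"]) simp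
  qed
  then obtain p where p: "\<And>K v. K \<in> T \<Longrightarrow> v extreme_point_of K \<Longrightarrow> fst (p K) \<bullet> v + snd (p K) = f v"
    unfolding bchoice_iff by blast
  define g where "g K x = fst (p K) \<bullet> x + snd (p K)" for K x
  have agree: "g K x = g K' x" if K: "K \<in> T" "K' \<in> T" and x: "x \<in> K" "x \<in> K'" for K K' x
  proof -
    have F: "(K \<inter> K') face_of K" "(K \<inter> K') face_of K'"
      using T K unfolding triangulation_def by (blast, metis Int_commute)
    obtain n where "n simplex K" using simp K by blast
    then obtain c where c: "c \<subseteq> {v. v extreme_point_of K}" "K \<inter> K' = convex hull c"
      using iffD1[OF simplex_face_iff F(1)] by blast
    \<comment> \<open>A vertex of \<open>K\<close> lying in the common face is extreme in that face,
      and hence in \<open>K'\<close> as well.\<close>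
    have "v extreme_point_of K" "v extreme_point_of K'" if "v \<in> c" for v
    proof -
      show *: "v extreme_point_of K" using c that by blast
      have "v \<in> K \<inter> K'" using c that hull_inc[of v c] by simp
      then show "v extreme_point_of K'" using * F extreme_point_of_face by blast
    qed
    then have "g K v = g K' v" if "v \<in> c" for v using p K that unfolding g_def by simp
    then show ?thesis using affine_eq_on_hull[of c] x c(2) unfolding g_def by blast
  qed
  define \<phi> where "\<phi> x = (if x \<in> \<Union>T then g (SOME K. K \<in> T \<and> x \<in> K) x else 0)" for x
  \<comment> \<open>By \<open>agree\<close>, the choice of simplex in the definition of
    \<open>\<phi>\<close> does not affect the value.\<close>
  have \<phi>: "\<phi> x = g K x" if "K \<in> T" "x \<in> K" for K x
  proof -
    have "(SOME K. K \<in> T \<and> x \<in> K) \<in> T \<and> x \<in> (SOME K. K \<in> T \<and> x \<in> K)"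
      by (rule someI[of "\<lambda>K. K \<in> T \<and> x \<in> K" K]) (use that in blast)
    then have "g (SOME K. K \<in> T \<and> x \<in> K) x = g K x"
      using agree[OF _ that(1) _ that(2)] by blast
    then show ?thesis using that unfolding \<phi>_def by auto
  qed
  have "continuous_on (\<Union>K\<in>T. K) \<phi>"
  proof (rule continuous_on_closed_Union)
    show "finite T" using T unfolding triangulation_def by blast
    show "closed K" if "K \<in> T" for K using simp closed_simplex that by blast
    show "continuous_on K \<phi>" if "K \<in> T" for K
    proof -
      have "continuous_on K (g K)" unfolding g_def by (intro continuous_intros)
      then show ?thesis using \<phi> that by (simp cong: continuous_on_cong)
    qed
  qed
  moreover have "piecewise_affine T \<phi>"
    unfolding piecewise_affine_def using \<phi> unfolding g_def by blast
  moreover have "\<phi> w = f w" if w: "w \<in> mesh_vertices T" for w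
  proof -
    obtain K where K: "K \<in> T" "w extreme_point_of K" using w unfolding mesh_vertices_def by blast
    then have "w \<in> K" by (simp add: extreme_point_of_def)
    then show ?thesis using \<phi> K p unfolding g_def by simp
  qed
  moreover have "\<phi> x = 0" if "x \<notin> \<Union>T" for x using that by (simp add: \<phi>_def)
  ultimately show "\<exists>\<phi>. continuous_on (\<Union>T) \<phi> \<and> piecewise_affine T \<phi> \<and>
     (\<forall>w\<in>mesh_vertices T. \<phi> w = f w) \<and> (\<forall>x. x \<notin> \<Union>T \<longrightarrow> \<phi> x = 0)"
    by (intro exI[of _ \<phi>]) simp
next
  fix \<phi> \<psi>
  assume \<phi>: "continuous_on (\<Union>T) \<phi> \<and> piecewise_affine T \<phi> \<and>
     (\<forall>w\<in>mesh_vertices T. \<phi> w = f w) \<and> (\<forall>x. x \<notin> \<Union>T \<longrightarrow> \<phi> x = 0)"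
  assume \<psi>: "continuous_on (\<Union>T) \<psi> \<and> piecewise_affine T \<psi> \<and>
     (\<forall>w\<in>mesh_vertices T. \<psi> w = f w) \<and> (\<forall>x. x \<notin> \<Union>T \<longrightarrow> \<psi> x = 0)"
  have "\<phi> x = \<psi> x" for x
  proof (cases "x \<in> \<Union>T")
    case True
    then obtain K where K: "K \<in> T" "x \<in> K" by blast
    obtain a b where a: "\<forall>x\<in>K. \<phi> x = a \<bullet> x + b"
      using \<phi> K unfolding piecewise_affine_def by blast
    obtain a' b' where a': "\<forall>x\<in>K. \<psi> x = a' \<bullet> x + b'"
      using \<psi> K unfolding piecewise_affine_def by blast
    have "K = convex hull {v. v extreme_point_of K}"
      using T K simplex_extreme_points(2) unfolding triangulation_def by blast
    then have x: "x \<in> convex hull {v. v extreme_point_of K}"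
      by (rule subst[of K _ "\<lambda>X. x \<in> X", OF _ K(2)])
    have eq: "a \<bullet> v + b = a' \<bullet> v + b'" if "v extreme_point_of K" for v
    proof -
      have "v \<in> K" using that by (simp add: extreme_point_of_def)
      moreover have "v \<in> mesh_vertices T" using that K unfolding mesh_vertices_def by blast
      ultimately show ?thesis using \<phi> \<psi> a a' by metis
    qed
    have "a \<bullet> x + b = a' \<bullet> x + b'"
      by (rule affine_eq_on_hull[OF _ x]) (rule eq, rule CollectD)
    then show ?thesis using bspec[OF a K(2)] bspec[OF a' K(2)] by simp
  qed (use \<phi> \<psi> in simp)
  then show "\<phi> = \<psi>" by blast
qed

text \<open>Unique interpolation of Kronecker data shows that the definite description in
  \<open>nodal_basis\<close> denotes.\<close>

lemma nodal_basis_vertex: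
  assumes "triangulation T" "w \<in> mesh_vertices T"
  shows "nodal_basis T z w = (if w = z then 1 else 0)"
proof -
  define P where "P \<phi> \<longleftrightarrow> continuous_on (\<Union>T) \<phi> \<and> piecewise_affine T \<phi> \<and>
     (\<forall>w\<in>mesh_vertices T. \<phi> w = (if w = z then 1 else 0)) \<and> (\<forall>x. x \<notin> \<Union>T \<longrightarrow> \<phi> x = 0)" for \<phi>
  have "\<exists>!\<phi>. P \<phi>"
    unfolding P_def by (rule piecewise_affine_interpolation[OF assms(1)])
  then have "P (THE \<phi>. P \<phi>)" by (rule theI')
  moreover have "(THE \<phi>. P \<phi>) = nodal_basis T z"
    unfolding nodal_basis_def P_def piecewise_affine_def by simp
  ultimately show ?thesis using assms(2) by (simp add: P_def)
qed

text \<open>The dual piece of \<open>z\<close> is the part of the simplex on which the barycentric coordinate of \<open>z\<close> is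
  maximal. For definiteness of the lumped mass it suffices that the pieces are separated by the
  level \<open>1/2\<close> of the coordinate.\<close>

lemma dual_piece_le_half:
  fixes K :: "(real^'d) set"
  assumes K: "n simplex K" and w: "w extreme_point_of K" "w \<noteq> z"
    and coord: "\<And>v. v extreme_point_of K \<Longrightarrow> a \<bullet> v + b = (if v = z then 1 else 0)"
    and x: "x \<in> dual_piece w K"
  shows "a \<bullet> x + b \<le> 1/2"
proof (rule affine_le_on_hull)
  show "x \<in> convex hull {barycenter F | F. F face_of K \<and> w \<in> F}"
    using x by (simp add: dual_piece_def)
next
  fix y assume "y \<in> {barycenter F | F. F face_of K \<and> w \<in> F}"
  then obtain F where F: "y = barycenter F" "F face_of K" "w \<in> F" by blast
  note C = simplex_extreme_points[OF K]
  obtain c where c: "c \<subseteq> {v. v extreme_point_of K}" "F = convex hull c"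
    using iffD1[OF simplex_face_iff[OF K] F(2)] by blast
  have ext: "{v. v extreme_point_of F} = c"
    using simplex_face_extreme_points[OF K c(1)] c(2) by simp
  have "w \<in> c" using ext F w extreme_point_of_face by blast
  have "finite c" using c C(4) finite_subset by blast
  define m where "m = card c"
  have m: "m > 0" unfolding m_def using \<open>w \<in> c\<close> \<open>finite c\<close> card_gt_0_iff by blast
  have y: "y = (\<Sum>v\<in>c. v) /\<^sub>R real m" using F(1) ext by (simp add: barycenter_def m_def)
  \<comment> \<open>At a barycenter the coordinate is the mean of its vertex values:
    \<open>1 / m\<close> if \<open>z\<close> belongs to the face, else 0. A face containing both
    \<open>z\<close> and \<open>w\<close> has at least two vertices.\<close>
  have "a \<bullet> y + b = (\<Sum>v\<in>c. a \<bullet> v + b) / m"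
    using m by (simp add: y inner_sum_right sum.distrib m_def field_simps)
  also have "(\<Sum>v\<in>c. a \<bullet> v + b) = (\<Sum>v\<in>c. if v = z then 1 else 0)"
    using c coord by (intro sum.cong) auto
  also have "\<dots> = (if z \<in> c then 1 else 0)" using \<open>finite c\<close> by simp
  also have "\<dots> / m \<le> 1/2"
  proof (cases "z \<in> c")
    case True
    then have "card {z, w} \<le> card c" using \<open>w \<in> c\<close> \<open>finite c\<close> by (intro card_mono) auto
    then have "2 \<le> m" using w(2) by (simp add: m_def)
    then show ?thesis using True by (simp add: field_simps)
  qed simp
  finally show "a \<bullet> y + b \<le> 1/2" .
qed

text \<open>The part of \<open>K\<close> with coordinate at least 1/2 is the image of
  \<open>K\<close> under the homothety of ratio 1/2 centred at \<open>z\<close>. Its vertices are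
  \<open>z\<close> and the midpoints of the edges at \<open>z\<close>, all of them barycenters of
  faces containing \<open>z\<close>.\<close>

lemma dual_piece_ge_half:
  fixes K :: "(real^'d) set"
  assumes K: "n simplex K" and z: "z extreme_point_of K"
    and coord: "\<And>v. v extreme_point_of K \<Longrightarrow> a \<bullet> v + b = (if v = z then 1 else 0)"
    and x: "x \<in> K" "a \<bullet> x + b \<ge> 1/2"
  shows "x \<in> dual_piece z K"
proof -
  define C where "C = {v. v extreme_point_of K}"
  note C = simplex_extreme_points[OF K, folded C_def]
  have zC: "z \<in> C" using z by (simp add: C_def)
  obtain u where u: "\<forall>v\<in>C. 0 \<le> u v" "sum u C = 1" "(\<Sum>v\<in>C. u v *\<^sub>R v) = x"
    using x(1) C(2) convex_hull_finite[OF C(4)] by blast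
  have "a \<bullet> x + b = (\<Sum>v\<in>C. u v * (a \<bullet> v)) + b * (\<Sum>v\<in>C. u v)"
    by (simp add: u(2) u(3)[symmetric] inner_sum_right)
  also have "\<dots> = (\<Sum>v\<in>C. u v * (a \<bullet> v + b))"
    by (simp add: sum_distrib_left sum.distrib algebra_simps)
  also have "\<dots> = (\<Sum>v\<in>C. if v = z then u v else 0)"
    using coord by (intro sum.cong) (auto simp: C_def)
  also have "\<dots> = u z" using C(4) zC by simp
  finally have uz: "u z \<ge> 1/2" using x(2) by simp
  \<comment> \<open>These are the barycentric coordinates of \<open>2 x - z\<close>, the preimage of
    \<open>x\<close> under the homothety; the one at \<open>z\<close> is nonnegative because
    \<open>u z\<close> is at least 1/2.\<close>
  define u' where "u' v = 2 * u v - (if v = z then 1 else 0)" for v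
  define B where "B = {barycenter F | F. F face_of K \<and> z \<in> F}"
  have mid: "(1/2) *\<^sub>R (v + z) \<in> B" if v: "v \<in> C" for v
  proof -
    have "convex hull {z, v} face_of K"
      using v zC by (intro iffD2[OF simplex_face_iff[OF K]] exI[of _ "{z, v}"]) (simp add: C_def)
    moreover have "barycenter (convex hull {z, v}) = (1/2) *\<^sub>R (v + z)"
    proof -
      have "{w. w extreme_point_of (convex hull {z, v})} = {z, v}"
        using v zC by (intro simplex_face_extreme_points[OF K]) (simp add: C_def)
      \<comment> \<open>For \<open>v = z\<close> the edge degenerates to a point, whose barycenter
        is \<open>z\<close>.\<close>
      then show ?thesis
        by (cases "v = z") (simp_all add: barycenter_def add.commute scaleR_half_double[symmetric])
    qed
    moreover have "z \<in> convex hull {z, v}" by (simp add: hull_inc)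
    ultimately show ?thesis unfolding B_def by force
  qed
  have "(\<Sum>v\<in>C. u' v *\<^sub>R ((1/2) *\<^sub>R (v + z))) \<in> convex hull B"
  proof (rule convex_sum[OF C(4) convex_convex_hull])
    show "(\<Sum>v\<in>C. u' v) = 1"
      using u(2) C(4) zC by (simp add: u'_def sum_subtractf sum_distrib_left[symmetric])
    show "0 \<le> u' v" if "v \<in> C" for v using uz u(1) that by (auto simp: u'_def)
    show "(1/2) *\<^sub>R (v + z) \<in> convex hull B" if "v \<in> C" for v using mid[OF that] by (rule hull_inc)
  qed
  moreover have "(\<Sum>v\<in>C. u' v *\<^sub>R ((1/2) *\<^sub>R (v + z))) = x"
  proof -
    have "u' v *\<^sub>R ((1/2) *\<^sub>R (v + z)) = u v *\<^sub>R v + u v *\<^sub>R z - (if v = z then z else 0)" for v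
      by (simp add: u'_def algebra_simps scaleR_add_left[symmetric])
    then have "(\<Sum>v\<in>C. u' v *\<^sub>R ((1/2) *\<^sub>R (v + z))) = x + (\<Sum>v\<in>C. u v) *\<^sub>R z - z"
      using C(4) zC by (simp add: sum_subtractf sum.distrib u(3) scaleR_sum_left)
    then show ?thesis by (simp add: u(2))
  qed
  ultimately show ?thesis by (simp add: dual_piece_def B_def)
qed

lemma dual_piece_subset:
  assumes "n simplex K" shows "dual_piece z K \<subseteq> K"
proof -
  have "barycenter F \<in> K" if F: "F face_of K" "z \<in> F" for F
  proof -
    note C = simplex_extreme_points[OF assms]
    obtain c where c: "c \<subseteq> {v. v extreme_point_of K}" "F = convex hull c"
      using iffD1[OF simplex_face_iff[OF assms] F(1)] by blast
    have ext: "{v. v extreme_point_of F} = c"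
      using simplex_face_extreme_points[OF assms c(1)] c(2) by simp
    have fin: "finite c" using c C(4) finite_subset by blast
    have "c \<noteq> {}" using F c by auto
    have "(\<Sum>v\<in>c. (1 / real (card c)) *\<^sub>R v) \<in> convex hull c"
      using fin \<open>c \<noteq> {}\<close> by (intro convex_sum convex_convex_hull) (auto simp: hull_inc)
    moreover have "barycenter F = (\<Sum>v\<in>c. (1 / real (card c)) *\<^sub>R v)"
      by (simp add: barycenter_def ext scaleR_sum_right inverse_eq_divide)
    ultimately show ?thesis using c F face_of_imp_subset by fastforce
  qed
  then show ?thesis
    unfolding dual_piece_def by (intro hull_minimal convex_simplex[OF assms]) auto
qed

text \<open>A proper face misses the interior. A common point would force \<open>K\<close> to be a
  proper face of \<open>K'\<close>, although that point is then interior to \<open>K'\<close>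
  too.\<close>

lemma triangulation_interior_disjoint:
  fixes T :: "(real^'d) set set"
  assumes T: "triangulation T" and K: "K \<in> T" "K' \<in> T" "K \<noteq> K'"
  shows "interior K \<inter> K' = {}"
proof (rule ccontr)
  assume "interior K \<inter> K' \<noteq> {}"
  then obtain x where x: "x \<in> interior K" "x \<in> K'" by blast
  have F: "(K \<inter> K') face_of K" "(K \<inter> K') face_of K'"
    using T K unfolding triangulation_def by (blast, metis Int_commute)
  have "K \<inter> K' = K"
    using face_of_disjoint_interior[OF F(1)] x interior_subset by blast
  then have "K face_of K'" "K \<subseteq> K'" using F by auto
  then have "K \<inter> interior K' = {}" using face_of_disjoint_interior K(3) by blast
  moreover have "x \<in> interior K'" using x interior_mono[OF \<open>K \<subseteq> K'\<close>] by blast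
  ultimately show False using x interior_subset by blast
qed

text \<open>\<open>U\<close> is the part of the interior of one simplex at \<open>z\<close> where
  the coordinate of \<open>z\<close> exceeds 1/2. Pieces of other vertices in the same simplex stay
  at or below 1/2, and pieces in other simplices cannot reach its interior.\<close>

lemma dual_cell_core:
  fixes S :: "(real^'d) set"
  assumes S: "open S" "convex S" and T: "conforming_mesh S T" and z: "z \<in> mesh_vertices T"
  shows "\<exists>U. open U \<and> U \<noteq> {} \<and> U \<subseteq> S \<and> U \<subseteq> dual_cell T z \<and>
    (\<forall>w. w \<noteq> z \<longrightarrow> U \<inter> dual_cell T w = {})"
proof -
  have tri: "triangulation T" and simp: "\<And>K. K \<in> T \<Longrightarrow> int CARD('d) simplex K"
    and cover: "\<Union>T = closure S"
    using T unfolding conforming_mesh_def by auto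
  obtain K where K: "K \<in> T" "z extreme_point_of K" using z unfolding mesh_vertices_def by blast
  note C = simplex_extreme_points[OF simp[OF K(1)]]
  obtain a b where "\<forall>v\<in>{v. v extreme_point_of K}. a \<bullet> v + b = (if v = z then 1 else 0)"
    using affine_interpolation[OF C(1), of "\<lambda>v. if v = z then 1 else 0"] by blast
  then have coord: "\<And>v. v extreme_point_of K \<Longrightarrow> a \<bullet> v + b = (if v = z then 1 else 0)" by blast
  define U where "U = interior K \<inter> {x. a \<bullet> x > 1/2 - b}"
  have "open U" unfolding U_def by (intro open_Int open_interior open_halfspace_gt)
  \<comment> \<open>The vertex \<open>z\<close> is a limit of interior points of \<open>K\<close>,
    and its coordinate 1 lies in the open half-space.\<close>
  moreover have "U \<noteq> {}"
  proof -
    have "card {v. v extreme_point_of K} = Suc DIM(real^'d)" using C(3) by simp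
    then have "interior K \<noteq> {}" using C(1,2) interior_convex_hull_eq_empty by metis
    moreover have "convex K" using simp K convex_simplex by blast
    ultimately have "closure (interior K) = closure K" by (rule convex_closure_interior[rotated])
    moreover have "z \<in> K" using K by (simp add: extreme_point_of_def)
    ultimately have "z \<in> closure (interior K)" using closure_subset by blast
    moreover have "z \<in> {x. a \<bullet> x > 1/2 - b}" using coord[OF K(2)] by (simp add: algebra_simps)
    moreover have "open {x. a \<bullet> x > 1/2 - b}" by (rule open_halfspace_gt)
    ultimately show ?thesis
      using open_Int_closure_eq_empty[of "{x. a \<bullet> x > 1/2 - b}" "interior K"] unfolding U_def by blast
  qed
  moreover have "U \<subseteq> S"
  proof -
    have "interior K \<subseteq> interior (closure S)" using K cover by (intro interior_mono) blast
    also have "\<dots> = S" using convex_interior_closure S interior_open by blast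
    finally show ?thesis by (auto simp: U_def)
  qed
  moreover have "U \<subseteq> dual_cell T z"
  proof
    fix x assume "x \<in> U"
    then have "x \<in> K" "a \<bullet> x + b \<ge> 1/2" using interior_subset by (auto simp: U_def)
    then have "x \<in> dual_piece z K" using dual_piece_ge_half[OF simp[OF K(1)] K(2) coord] by blast
    then show "x \<in> dual_cell T z" using K by (auto simp: dual_cell_def)
  qed
  moreover have "U \<inter> dual_cell T w = {}" if w: "w \<noteq> z" for w
  proof (rule ccontr)
    assume "U \<inter> dual_cell T w \<noteq> {}"
    then obtain x L where x: "x \<in> U" and L: "L \<in> T" "w extreme_point_of L" "x \<in> dual_piece w L"
      unfolding dual_cell_def by blast
    have "x \<in> L" using dual_piece_subset simp L by blast
    then have "L = K" using triangulation_interior_disjoint[OF tri K(1) L(1)] x by (auto simp: U_def)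
    then have "a \<bullet> x + b \<le> 1/2"
      using dual_piece_le_half[OF simp[OF K(1)] _ w coord] L by blast
    then show False using x by (simp add: U_def)
  qed
  ultimately show ?thesis by blast
qed

text \<open>Compactness provides the measurability of the indicator functions that span the dual
  space.\<close>

lemma compact_dual_cell:
  assumes "triangulation T" shows "compact (dual_cell T z)"
  unfolding dual_cell_def
proof (rule compact_UN)
  show "finite {K \<in> T. z extreme_point_of K}" using assms unfolding triangulation_def by simp
  fix K assume "K \<in> {K \<in> T. z extreme_point_of K}"
  then obtain n where "n simplex K" using assms unfolding triangulation_def by blast
  then have "finite {F. F face_of K}" by (intro finite_polytope_faces simplex_imp_polytope)
  then have "finite {barycenter F | F. F face_of K \<and> z \<in> F}" by simp
  then show "compact (dual_piece z K)"
    unfolding dual_piece_def by (rule finite_imp_compact_convex_hull)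
qed

section \<open>The lumped inner product\<close>

lemma L2_space_measurable: "f \<in> L2_space S \<Longrightarrow> f \<in> borel_measurable (lebesgue_on S)"
  by (simp add: L2_space_def)

lemma L2_space_integrable_mult:
  assumes "f \<in> L2_space S" "g \<in> L2_space S"
  shows "integrable (lebesgue_on S) (\<lambda>x. f x * g x)"
proof (rule Bochner_Integration.integrable_bound)
  show "integrable (lebesgue_on S) (\<lambda>x. (f x)\<^sup>2 + (g x)\<^sup>2)"
    using assms by (auto simp: L2_space_def)
  show "(\<lambda>x. f x * g x) \<in> borel_measurable (lebesgue_on S)"
    using assms[THEN L2_space_measurable] by measurable
  have "\<bar>s * t\<bar> \<le> s\<^sup>2 + t\<^sup>2" for s t :: real
  proof -
    have "0 \<le> (\<bar>s\<bar> - \<bar>t\<bar>)\<^sup>2" "0 \<le> s\<^sup>2" "0 \<le> t\<^sup>2" by simp_all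
    moreover have "(\<bar>s\<bar> - \<bar>t\<bar>)\<^sup>2 = s\<^sup>2 + t\<^sup>2 - 2 * \<bar>s * t\<bar>"
      by (simp add: power2_eq_square algebra_simps abs_mult)
    ultimately show ?thesis by linarith
  qed
  then show "AE x in lebesgue_on S. norm (f x * g x) \<le> norm ((f x)\<^sup>2 + (g x)\<^sup>2)"
    by simp
qed

lemma L2_inner_commute: "L2_inner S f g = L2_inner S g f"
  by (simp add: L2_inner_def mult.commute)

lemma L2_inner_add_left:
  assumes "f \<in> L2_space S" "g \<in> L2_space S" "k \<in> L2_space S"
  shows "L2_inner S (\<lambda>x. f x + g x) k = L2_inner S f k + L2_inner S g k"
  using assms by (simp add: L2_inner_def distrib_right L2_space_integrable_mult)

lemma L2_inner_diff_left:
  assumes "f \<in> L2_space S" "g \<in> L2_space S" "k \<in> L2_space S"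
  shows "L2_inner S (\<lambda>x. f x - g x) k = L2_inner S f k - L2_inner S g k"
  using assms by (simp add: L2_inner_def left_diff_distrib L2_space_integrable_mult)

lemma L2_inner_scale_left: "L2_inner S (\<lambda>x. c * f x) k = c * L2_inner S f k"
  by (simp add: L2_inner_def mult.assoc)

lemma L2_inner_cong_AE:
  assumes "f \<in> L2_space S" "g \<in> L2_space S" "k \<in> L2_space S"
    and "AE x in lebesgue_on S. f x = g x"
  shows "L2_inner S f k = L2_inner S g k"
  unfolding L2_inner_def
proof (rule integral_cong_AE)
  show "(\<lambda>x. f x * k x) \<in> borel_measurable (lebesgue_on S)"
    "(\<lambda>x. g x * k x) \<in> borel_measurable (lebesgue_on S)"
    using assms(1-3)[THEN L2_space_measurable] by measurable
  show "AE x in lebesgue_on S. f x * k x = g x * k x"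
    using assms(4) by eventually_elim simp
qed

lemma function_subspace_L2: "function_subspace (L2_space S)"
  unfolding function_subspace_def
proof (intro conjI ballI allI)
  show "(\<lambda>x. 0) \<in> L2_space S" by (simp add: L2_space_def)
  show "(\<lambda>x. f x + g x) \<in> L2_space S" if f: "f \<in> L2_space S" "g \<in> L2_space S" for f g
  proof -
    have "integrable (lebesgue_on S) (\<lambda>x. f x * f x + 2 * (f x * g x) + g x * g x)"
      using f by (intro Bochner_Integration.integrable_add integrable_mult_right L2_space_integrable_mult)
    moreover have "(\<lambda>x. f x * f x + 2 * (f x * g x) + g x * g x) = (\<lambda>x. (f x + g x)\<^sup>2)"
      by (simp add: power2_eq_square algebra_simps)
    ultimately have "integrable (lebesgue_on S) (\<lambda>x. (f x + g x)\<^sup>2)" by simp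
    moreover have "(\<lambda>x. f x + g x) \<in> borel_measurable (lebesgue_on S)"
      using f[THEN L2_space_measurable] by measurable
    ultimately show ?thesis by (simp add: L2_space_def)
  qed
  show "(\<lambda>x. c * f x) \<in> L2_space S" if "f \<in> L2_space S" for c f
    using that by (auto simp: L2_space_def power_mult_distrib)
qed

text \<open>A nonnegative integrable function has integral 0 exactly when it vanishes almost
  everywhere; here the function is the squared difference.\<close>

lemma ip_eq_L2_iff:
  assumes "f \<in> L2_space S" "g \<in> L2_space S"
  shows "ip_eq (L2_inner S) f g \<longleftrightarrow> (AE x in lebesgue_on S. f x = g x)"
proof -
  have d: "(\<lambda>x. f x - g x) \<in> L2_space S"
    by (rule function_subspace_diff[OF function_subspace_L2 assms])
  have "ip_eq (L2_inner S) f g \<longleftrightarrow> (AE x in lebesgue_on S. (f x - g x) * (f x - g x) = 0)"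
    unfolding ip_eq_def L2_inner_def
    by (rule integral_nonneg_eq_0_iff_AE[OF L2_space_integrable_mult[OF d d]]) simp
  then show ?thesis by simp
qed

section \<open>The lumping map, its injectivity and definiteness of the lumped mass\<close>

lemma lump_scale: "lump bc S T (\<lambda>x. c * u x) = (\<lambda>x. c * lump bc S T u x)"
  by (simp add: lump_def sum_distrib_left mult.assoc)

lemma lump_add: "lump bc S T (\<lambda>x. u x + v x) = (\<lambda>x. lump bc S T u x + lump bc S T v x)"
  by (simp add: lump_def sum.distrib distrib_right)

lemma lump_sum:
  "lump bc S T (\<lambda>x. \<Sum>i\<in>I. c i * g i x) = (\<lambda>x. \<Sum>i\<in>I. c i * lump bc S T (g i) x)"
proof
  fix x
  have "lump bc S T (\<lambda>x. \<Sum>i\<in>I. c i * g i x) x =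
      (\<Sum>z\<in>active_vertices bc S T. \<Sum>i\<in>I. c i * g i z * indicat_real (dual_cell T z) x)"
    by (simp add: lump_def sum_distrib_right)
  also have "\<dots> = (\<Sum>i\<in>I. \<Sum>z\<in>active_vertices bc S T. c i * g i z * indicat_real (dual_cell T z) x)"
    by (rule sum.swap)
  also have "\<dots> = (\<Sum>i\<in>I. c i * lump bc S T (g i) x)"
    by (simp add: lump_def sum_distrib_left mult.assoc)
  finally show "lump bc S T (\<lambda>x. \<Sum>i\<in>I. c i * g i x) x = \<dots>" .
qed

lemma lump_zero: "lump bc S T (\<lambda>x. 0) = (\<lambda>x. 0)"
  by (simp add: lump_def)

locale lumped_mesh =
  fixes bc :: boundary_condition and S :: "(real^'d) set" and T :: "(real^'d) set set"
  assumes domain: "open S" "bounded S" "convex S"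
    and mesh: "conforming_mesh S T"
begin

abbreviation "Z \<equiv> active_vertices bc S T"
abbreviation "V \<equiv> fe_space bc S T"
abbreviation "Q \<equiv> lump bc S T"
abbreviation "q \<equiv> lumped_inner bc S T"

lemma triangulation: "triangulation T"
  using mesh by (simp add: conforming_mesh_def)

lemma active_vertices_subset: "Z \<subseteq> mesh_vertices T"
  by (auto simp: active_vertices_def split: boundary_condition.splits)

lemma finite_active_vertices: "finite Z"
  using finite_mesh_vertices[OF triangulation] active_vertices_subset finite_subset by blast

lemma fe_space_eq_span: "V = function_span Z (nodal_basis T)"
  by (simp add: fe_space_def function_span_def)

text \<open>The Kronecker property of the nodal basis identifies the coefficients with vertex
  values, so a finite element function is determined by its values at the active vertices.\<close>

lemma fe_space_expansion:
  assumes "u \<in> V" shows "u = (\<lambda>x. \<Sum>z\<in>Z. u z * nodal_basis T z x)"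
proof -
  obtain c where c: "u = (\<lambda>x. \<Sum>z\<in>Z. c z * nodal_basis T z x)"
    using assms unfolding fe_space_def by blast
  have "u w = c w" if "w \<in> Z" for w
  proof -
    have "u w = (\<Sum>z\<in>Z. if w = z then c z else 0)"
      unfolding c using nodal_basis_vertex[OF triangulation] that active_vertices_subset
      by (intro sum.cong) auto
    also have "\<dots> = c w" using finite_active_vertices that by simp
    finally show ?thesis .
  qed
  then have "(\<lambda>x. \<Sum>z\<in>Z. u z * nodal_basis T z x) = (\<lambda>x. \<Sum>z\<in>Z. c z * nodal_basis T z x)"
    by simp
  then show ?thesis using c by simp
qed

lemma sets_S: "S \<in> sets lebesgue"
  using domain(1) by (simp add: borel_open)

text \<open>A bounded domain has finite measure, so indicators of measurable cells are square
  integrable.\<close>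

lemma lump_L2: "Q u \<in> L2_space S"
proof -
  have ind: "indicat_real (dual_cell T z) \<in> L2_space S" for z
  proof -
    have "dual_cell T z \<in> sets lebesgue"
      using compact_dual_cell[OF triangulation, of z] by (simp add: borel_compact)
    then have "dual_cell T z \<inter> S \<in> sets (lebesgue_on S)"
      using sets_S by (auto simp: sets_restrict_space)
    then have m: "indicat_real (dual_cell T z) \<in> borel_measurable (lebesgue_on S)"
      by (simp add: borel_measurable_indicator_iff Int_commute)
    have "finite_measure (lebesgue_on S)"
      using finite_measure_lebesgue_on bounded_set_imp_lmeasurable domain(2) sets_S by blast
    then have "integrable (lebesgue_on S) (\<lambda>x. 1 :: real)"
      by (rule finite_measure.integrable_const)
    then have "integrable (lebesgue_on S) (indicat_real (dual_cell T z))"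
      using m by (rule Bochner_Integration.integrable_bound) (simp add: indicator_def)
    moreover have "(\<lambda>x. (indicat_real (dual_cell T z) x)\<^sup>2) = indicat_real (dual_cell T z)"
      by (auto simp: indicator_def)
    ultimately show ?thesis using m by (simp add: L2_space_def)
  qed
  show ?thesis
    unfolding lump_def
    by (rule function_subspace_sum[OF function_subspace_L2 finite_active_vertices ind])
qed

text \<open>On the open set from \<open>dual_cell_core\<close>, \<open>Q u\<close> is constantly
  \<open>u z\<close>. As a nonempty open set is not negligible, every active vertex value
  vanishes.\<close>

lemma lump_AE_eq_0:
  assumes u: "u \<in> V" and "AE x in lebesgue_on S. Q u x = 0"
  shows "u = (\<lambda>x. 0)"
proof -
  have "u z = 0" if z: "z \<in> Z" for z
  proof (rule ccontr)
    assume nz: "u z \<noteq> 0"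
    obtain U where U: "open U" "U \<noteq> {}" "U \<subseteq> S" "U \<subseteq> dual_cell T z"
      "\<forall>w. w \<noteq> z \<longrightarrow> U \<inter> dual_cell T w = {}"
      using dual_cell_core[OF domain(1,3) mesh subsetD[OF active_vertices_subset z]]
      by blast
    have Qu: "Q u x = u z" if "x \<in> U" for x
    proof -
      have "Q u x = (\<Sum>w\<in>Z. if w = z then u w else 0)"
        unfolding lump_def using U that by (intro sum.cong) (auto simp: indicator_def)
      then show ?thesis using finite_active_vertices z by simp
    qed
    have "AE x in lebesgue. x \<in> S \<longrightarrow> Q u x = 0"
      using assms(2) sets_S by (simp add: AE_restrict_space_iff)
    then have "AE x in lebesgue. x \<notin> U"
      by eventually_elim (use U Qu nz in auto)
    moreover have "U \<in> sets lebesgue" using U by (simp add: borel_open)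
    ultimately have "U \<in> null_sets lebesgue" by (simp add: AE_iff_null_sets)
    then have "negligible U" by (simp add: negligible_iff_null_sets)
    then show False using open_not_negligible U by blast
  qed
  then show ?thesis using fe_space_expansion[OF u] by simp
qed

sublocale q: finite_dimensional_inner_product Z "nodal_basis T" V q
proof
  show "finite Z" by (rule finite_active_vertices)
  show "V = function_span Z (nodal_basis T)" by (rule fe_space_eq_span)
  show "symmetric_bilinear_on V q"
    unfolding symmetric_bilinear_on_def lumped_inner_def
    by (simp add: lump_add lump_scale L2_inner_add_left L2_inner_scale_left lump_L2)
      (simp add: L2_inner_commute)
  show "positive_definite_on V q"
    unfolding positive_definite_on_def
  proof (intro ballI impI)
    fix u assume u: "u \<in> V" "u \<noteq> (\<lambda>x. 0)"
    have "\<not> ip_eq (L2_inner S) (Q u) (Q (\<lambda>x. 0))"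
      using ip_eq_L2_iff[OF lump_L2 lump_L2, of u "\<lambda>x. 0"] lump_AE_eq_0 u by (auto simp: lump_zero)
    then have "q u u \<noteq> 0" by (simp add: ip_eq_def lumped_inner_def lump_zero)
    moreover have "q u u \<ge> 0" by (simp add: lumped_inner_def L2_inner_def)
    ultimately show "0 < q u u" by simp
  qed
qed

lemma lump_AE_cancel:
  assumes "u \<in> V" "v \<in> V" "AE x in lebesgue_on S. Q u x = Q v x"
  shows "u = v"
proof -
  have "Q (\<lambda>x. u x - v x) = (\<lambda>x. Q u x - Q v x)"
    using lump_add[of bc S T u "\<lambda>x. (-1) * v x"] lump_scale[of bc S T "-1" v] by simp
  then have "AE x in lebesgue_on S. Q (\<lambda>x. u x - v x) x = 0" using assms(3) by simp
  then have "(\<lambda>x. u x - v x) = (\<lambda>x. 0)"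
    using lump_AE_eq_0 function_subspace_diff[OF q.subspace_V assms(1,2)] by blast
  then show ?thesis by (simp add: fun_eq_iff)
qed

text \<open>Injectivity of \<open>Q\<close> modulo null sets resolves the definite description in
  \<open>lump_inverse\<close>, even when \<open>w\<close> agrees with \<open>Q u\<close> only almost
  everywhere.\<close>

lemma lump_inverse_eqI:
  assumes "u \<in> V" "AE x in lebesgue_on S. w x = Q u x"
  shows "lump_inverse bc S T w = u"
  unfolding lump_inverse_def
proof (rule the_equality)
  show "u \<in> V \<and> (AE x in lebesgue_on S. Q u x = w x)"
    using assms by (auto elim: eventually_mono)
  fix v assume v: "v \<in> V \<and> (AE x in lebesgue_on S. Q v x = w x)"
  then have "AE x in lebesgue_on S. Q v x = w x" by blast
  then have "AE x in lebesgue_on S. Q v x = Q u x"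
    using assms(2) by eventually_elim simp
  then show "v = u" using lump_AE_cancel v assms(1) by blast
qed

lemma linear_L2_inner_lump: "f \<in> L2_space S \<Longrightarrow> linear_functional_on V (\<lambda>v. L2_inner S f (Q v))"
  unfolding linear_functional_on_def
  by (simp add: lump_add lump_scale L2_inner_commute[of S f] L2_inner_add_left L2_inner_scale_left lump_L2)

end

section \<open>Eigenvalue problems for the discrete operators\<close>

locale lumped_problem = lumped_mesh bc S T
  for bc :: boundary_condition and S :: "(real^'d) set" and T :: "(real^'d) set set" +
  fixes a :: "(real^'d \<Rightarrow> real) \<Rightarrow> (real^'d \<Rightarrow> real) \<Rightarrow> real"
  assumes a_bilinear: "symmetric_bilinear_on (fe_space bc S T) a"
    and a_definite: "positive_definite_on (fe_space bc S T) a"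
begin

text \<open>The form \<open>a\<close> is itself an inner product on \<open>V\<close>, so Riesz
  representation and cancellation also apply to the discrete variational problem.\<close>

sublocale e: finite_dimensional_inner_product Z "nodal_basis T" V a
  using finite_active_vertices fe_space_eq_span a_bilinear a_definite
  by unfold_locales

abbreviation "LQ \<equiv> discrete_L V q a"
abbreviation "PQ \<equiv> discrete_P bc S T q"

text \<open>The weak eigenvalue problem for the pair of forms \<open>a\<close> and \<open>q\<close>,
  the common ground between \<open>LQ\<close> on \<open>V\<close> and \<open>Q \<circ> G\<close> on
  L2.\<close>

definition form_eigen_space :: "real \<Rightarrow> (real^'d \<Rightarrow> real) set" where
  "form_eigen_space l = {u \<in> V. \<forall>v\<in>V. a u v = l * q u v}"

definition form_eigen_values :: "real set" where
  "form_eigen_values = {l. \<exists>u\<in>V. u \<noteq> (\<lambda>x. 0) \<and> (\<forall>v\<in>V. a u v = l * q u v)}"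

lemma discrete_P_lumped:
  assumes "f \<in> L2_space S"
  shows "PQ f \<in> V" "\<And>v. v \<in> V \<Longrightarrow> q (PQ f) v = L2_inner S f (Q v)"
  using q.riesz_the[OF linear_L2_inner_lump[OF assms]] unfolding discrete_P_def by blast+

lemma discrete_L_lumped:
  assumes "u \<in> V"
  shows "LQ u \<in> V" "\<And>v. v \<in> V \<Longrightarrow> q (LQ u) v = a u v"
  using q.riesz_the[OF e.linear_ip_right[OF assms]] unfolding discrete_L_def by blast+

lemma form_eigen_space_subset: "form_eigen_space l \<subseteq> V"
  by (auto simp: form_eigen_space_def)

lemma form_eigen_space_iff: "u \<in> form_eigen_space l \<longleftrightarrow> u \<in> V \<and> (\<forall>v\<in>V. a u v = l * q u v)"
  by (simp add: form_eigen_space_def)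

lemma scale_V: "u \<in> V \<Longrightarrow> (\<lambda>x. c * u x) \<in> V"
  by (rule function_subspace_scale[OF q.subspace_V])

lemma function_subspace_form_eigen_space: "function_subspace (form_eigen_space l)"
  unfolding function_subspace_def
proof (intro conjI ballI allI)
  show "(\<lambda>x. 0) \<in> form_eigen_space l"
    by (simp add: form_eigen_space_iff function_subspace_zero[OF q.subspace_V] e.ip_zero_left q.ip_zero_left)
next
  fix u v assume uv: "u \<in> form_eigen_space l" "v \<in> form_eigen_space l"
  have "a (\<lambda>x. u x + v x) w = l * q (\<lambda>x. u x + v x) w" if "w \<in> V" for w
    using uv linear_functional_on_add[OF e.linear_ip_left[OF that], of u v]
      linear_functional_on_add[OF q.linear_ip_left[OF that], of u v] that
    by (simp add: form_eigen_space_iff distrib_left)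
  then show "(\<lambda>x. u x + v x) \<in> form_eigen_space l"
    using uv by (simp add: form_eigen_space_iff function_subspace_add[OF q.subspace_V])
next
  fix c u assume u: "u \<in> form_eigen_space l"
  have "a (\<lambda>x. c * u x) w = l * q (\<lambda>x. c * u x) w" if "w \<in> V" for w
    using u that by (simp add: form_eigen_space_iff e.ip_scale q.ip_scale)
  then show "(\<lambda>x. c * u x) \<in> form_eigen_space l"
    using u by (simp add: form_eigen_space_iff scale_V)
qed

text \<open>Both sides of the eigenvalue equation lie in \<open>V\<close>, where testing against all
  of \<open>V\<close> with the definite form \<open>q\<close> decides equality.\<close>

lemma eigen_space_LQ: "eigen_space V q LQ l = form_eigen_space l"
proof -
  have "ip_eq q (LQ u) (\<lambda>x. l * u x) \<longleftrightarrow> (\<forall>v\<in>V. a u v = l * q u v)" if u: "u \<in> V" for u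
  proof -
    have "ip_eq q (LQ u) (\<lambda>x. l * u x) \<longleftrightarrow> LQ u = (\<lambda>x. l * u x)"
      by (rule q.ip_eq_iff[OF discrete_L_lumped(1)[OF u] scale_V[OF u]])
    also have "\<dots> \<longleftrightarrow> (\<forall>v\<in>V. q (LQ u) v = q (\<lambda>x. l * u x) v)"
      using q.ip_cancel[OF q.subspace_V order_refl discrete_L_lumped(1)[OF u] scale_V[OF u]] by metis
    also have "\<dots> \<longleftrightarrow> (\<forall>v\<in>V. a u v = l * q u v)"
      using discrete_L_lumped(2)[OF u] q.ip_scale(1)[OF u] by simp
    finally show ?thesis .
  qed
  then show ?thesis by (auto simp: eigen_space_def form_eigen_space_def)
qed

lemma eigen_values_LQ: "eigen_values V q LQ = form_eigen_values"
proof -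
  have "ip_eq q u (\<lambda>x. 0) \<longleftrightarrow> u = (\<lambda>x. 0)" if "u \<in> V" for u
    using q.ip_eq_iff that function_subspace_zero[OF q.subspace_V] by blast
  then show ?thesis
    unfolding eigen_values_def eigen_space_LQ form_eigen_values_def form_eigen_space_def by auto
qed

lemma finite_form_eigen_values: "finite form_eigen_values"
  unfolding form_eigen_values_def by (rule q.finite_generalized_eigenvalues) (rule e.ip_commute)

text \<open>Testing with the eigenvector itself compares two positive numbers. Positivity makes
  \<open>1 / l\<close> nonzero and validates the law for reciprocal powers.\<close>

lemma form_eigen_values_pos: "l \<in> form_eigen_values \<Longrightarrow> 0 < l"
proof -
  assume "l \<in> form_eigen_values"
  then obtain u where u: "u \<in> V" "u \<noteq> (\<lambda>x. 0)" "a u u = l * q u u"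
    unfolding form_eigen_values_def by blast
  then have "0 < l * q u u" "0 < q u u" using e.ip_pos q.ip_pos by metis+
  then show "0 < l" by (simp add: zero_less_mult_iff)
qed

lemma fractional_TQ_in_V:
  assumes f: "f \<in> L2_space S"
  shows "fractional_TQ bc S T a \<beta> f \<in> V"
proof -
  have "orth_projection q (form_eigen_space l) (PQ f) \<in> V" for l
    using q.orth_projection(1)[OF function_subspace_form_eigen_space form_eigen_space_subset discrete_P_lumped(1)[OF f]] form_eigen_space_subset by blast
  then show ?thesis
    unfolding fractional_TQ_def spectral_fun_def eigen_values_LQ eigen_space_LQ
    by (intro function_subspace_sum[OF q.subspace_V finite_form_eigen_values])
qed

text \<open>This isolates what the spectral argument uses of \<open>T_h\<close>: a variational
  characterization in which no auxiliary inner product occurs.\<close>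

definition solution_operator :: "((real^'d \<Rightarrow> real) \<Rightarrow> real^'d \<Rightarrow> real) \<Rightarrow> bool" where
  "solution_operator G \<longleftrightarrow>
     (\<forall>f\<in>L2_space S. G f \<in> V \<and> (\<forall>v\<in>V. a (G f) v = L2_inner S f (Q v)))"

text \<open>The auxiliary inner product cancels: \<open>ip (L (T f)) v = a (T f) v\<close> and
  \<open>ip (P f) v = (f, Q v)\<close>.\<close>

lemma solution_operator_discrete_T:
  assumes ip: "symmetric_bilinear_on V ip" "positive_definite_on V ip"
  shows "solution_operator (discrete_T bc S T ip a)"
  unfolding solution_operator_def
proof
  fix f assume f: "f \<in> L2_space S"
  interpret p: finite_dimensional_inner_product Z "nodal_basis T" V ip
    using finite_active_vertices fe_space_eq_span ip by unfold_locales
  let ?L = "discrete_L V ip a" and ?P = "discrete_P bc S T ip f"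
  have P: "?P \<in> V" "\<And>v. v \<in> V \<Longrightarrow> ip ?P v = L2_inner S f (Q v)"
    using p.riesz_the[OF linear_L2_inner_lump[OF f]] unfolding discrete_P_def by blast+
  have L: "?L u \<in> V" "\<And>v. v \<in> V \<Longrightarrow> ip (?L u) v = a u v" if "u \<in> V" for u
    using p.riesz_the[OF e.linear_ip_right[OF that]] unfolding discrete_L_def by blast+
  \<comment> \<open>The candidate for \<open>T_h f\<close> is the Riesz representer with respect to
    \<open>a\<close>; its image under \<open>?L\<close> and \<open>?P\<close> have the same pairings
    under \<open>ip\<close>.\<close>
  obtain w where w: "w \<in> V" "\<And>v. v \<in> V \<Longrightarrow> a w v = L2_inner S f (Q v)"
    using e.riesz[OF e.subspace_V order_refl linear_L2_inner_lump[OF f]] by blast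
  have "?L w = ?P"
    by (rule p.ip_cancel[OF p.subspace_V order_refl L(1)[OF w(1)] P(1)]) (simp add: L w P)
  \<comment> \<open>Injectivity makes \<open>inv_into\<close> return \<open>w\<close> rather than
    some other preimage of \<open>?P\<close>.\<close>
  moreover have "inj_on ?L V"
  proof (rule inj_onI)
    fix u v assume uv: "u \<in> V" "v \<in> V" "?L u = ?L v"
    show "u = v"
      by (rule e.ip_cancel[OF e.subspace_V order_refl uv(1,2)]) (metis L(2) uv)
  qed
  ultimately have "discrete_T bc S T ip a f = w"
    unfolding discrete_T_def using w(1) by (metis inv_into_f_f)
  then show "discrete_T bc S T ip a f \<in> V \<and>
      (\<forall>v\<in>V. a (discrete_T bc S T ip a f) v = L2_inner S f (Q v))"
    using w by blast
qed

section \<open>Spectral correspondence between a solution operator and the lumped discrete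
  operator\<close>

context
  fixes G assumes G: "solution_operator G"
begin

lemma solution_operatorD:
  assumes "f \<in> L2_space S"
  shows "G f \<in> V" "\<And>v. v \<in> V \<Longrightarrow> a (G f) v = L2_inner S f (Q v)"
  using G assms unfolding solution_operator_def by blast+

lemma eigen_space_QG_raw:
  "f \<in> eigen_space (L2_space S) (L2_inner S) (Q \<circ> G) m \<longleftrightarrow>
     f \<in> L2_space S \<and> (AE x in lebesgue_on S. Q (G f) x = m * f x)"
  unfolding eigen_space_def
  using ip_eq_L2_iff[OF lump_L2 function_subspace_scale[OF function_subspace_L2]] by auto

text \<open>Forward, \<open>u\<close> is \<open>G f\<close> divided by \<open>m\<close>. Backward,
  \<open>f = Q u\<close> almost everywhere gives \<open>a (G f) v = q u v = m * a u v\<close>, and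
  cancellation in \<open>a\<close> yields \<open>G f = m u\<close>.\<close>

lemma eigen_space_QG:
  assumes m: "m \<noteq> 0"
  shows "f \<in> eigen_space (L2_space S) (L2_inner S) (Q \<circ> G) m \<longleftrightarrow>
     f \<in> L2_space S \<and> (\<exists>u\<in>form_eigen_space (1 / m). AE x in lebesgue_on S. f x = Q u x)"
proof (cases "f \<in> L2_space S")
  case f: True
  note Gf = solution_operatorD[OF f]
  have "(AE x in lebesgue_on S. Q (G f) x = m * f x) \<longleftrightarrow>
      (\<exists>u\<in>form_eigen_space (1 / m). AE x in lebesgue_on S. f x = Q u x)"
  proof
    assume ae: "AE x in lebesgue_on S. Q (G f) x = m * f x"
    define u where "u = (\<lambda>x. (1 / m) * G f x)"
    have uV: "u \<in> V" unfolding u_def by (rule scale_V[OF Gf(1)])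
    have "Q u = (\<lambda>x. (1 / m) * Q (G f) x)" unfolding u_def by (rule lump_scale)
    then have fu: "AE x in lebesgue_on S. f x = Q u x"
      using ae m by (auto elim!: eventually_mono)
    have "a u v = (1 / m) * q u v" if v: "v \<in> V" for v
    proof -
      have "a u v = (1 / m) * L2_inner S f (Q v)"
        unfolding u_def e.ip_scale(1)[OF Gf(1) v] Gf(2)[OF v] ..
      also have "L2_inner S f (Q v) = q u v"
        unfolding lumped_inner_def by (rule L2_inner_cong_AE[OF f lump_L2 lump_L2 fu])
      finally show ?thesis .
    qed
    then show "\<exists>u\<in>form_eigen_space (1 / m). AE x in lebesgue_on S. f x = Q u x"
      using uV fu by (auto simp: form_eigen_space_iff)
  next
    assume "\<exists>u\<in>form_eigen_space (1 / m). AE x in lebesgue_on S. f x = Q u x"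
    then obtain u where u: "u \<in> V" "\<And>v. v \<in> V \<Longrightarrow> a u v = (1 / m) * q u v"
      and fu: "AE x in lebesgue_on S. f x = Q u x"
      by (auto simp: form_eigen_space_iff)
    have "G f = (\<lambda>x. m * u x)"
    proof (rule e.ip_cancel[OF e.subspace_V order_refl Gf(1) scale_V[OF u(1)]])
      fix v assume v: "v \<in> V"
      have "a (G f) v = q u v"
        unfolding Gf(2)[OF v] lumped_inner_def by (rule L2_inner_cong_AE[OF f lump_L2 lump_L2 fu])
      also have "\<dots> = a (\<lambda>x. m * u x) v"
        using e.ip_scale(1)[OF u(1) v] u(2)[OF v] m by simp
      finally show "a (G f) v = a (\<lambda>x. m * u x) v" .
    qed
    then have "Q (G f) = (\<lambda>x. m * Q u x)" by (simp add: lump_scale)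
    then have QG: "Q (G f) x = m * Q u x" for x by simp
    from fu show "AE x in lebesgue_on S. Q (G f) x = m * f x"
      by eventually_elim (simp add: QG)
  qed
  then show ?thesis using f eigen_space_QG_raw by simp
qed (simp add: eigen_space_QG_raw)

text \<open>The value 0 is removed because its eigenspace is the kernel of
  \<open>Q \<circ> G\<close>, which has no counterpart for the positive operator \<open>LQ\<close>.
  For the others, injectivity of \<open>Q\<close> matches nonzero eigenvectors on both
  sides.\<close>

lemma eigen_values_QG:
  "eigen_values (L2_space S) (L2_inner S) (Q \<circ> G) - {0} = (\<lambda>l. 1 / l) ` form_eigen_values"
proof -
  have zero: "ip_eq (L2_inner S) f (\<lambda>x. 0) \<longleftrightarrow> (AE x in lebesgue_on S. f x = 0)"
    if "f \<in> L2_space S" for f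
    using ip_eq_L2_iff[OF that function_subspace_zero[OF function_subspace_L2]] .
  have iff: "m \<in> eigen_values (L2_space S) (L2_inner S) (Q \<circ> G) \<longleftrightarrow> 1 / m \<in> form_eigen_values" if m: "m \<noteq> 0" for m
  proof
    assume "m \<in> eigen_values (L2_space S) (L2_inner S) (Q \<circ> G)"
    then obtain f where f: "f \<in> eigen_space (L2_space S) (L2_inner S) (Q \<circ> G) m"
      "\<not> ip_eq (L2_inner S) f (\<lambda>x. 0)"
      unfolding eigen_values_def by blast
    then obtain u where u: "u \<in> form_eigen_space (1 / m)" "AE x in lebesgue_on S. f x = Q u x"
      using eigen_space_QG[OF m] by blast
    have "u \<noteq> (\<lambda>x. 0)"
    proof
      assume "u = (\<lambda>x. 0)"
      then have "AE x in lebesgue_on S. f x = 0" using u(2) by (simp add: lump_zero)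
      then show False using f zero eigen_space_QG[OF m] by blast
    qed
    then show "1 / m \<in> form_eigen_values" using u(1) unfolding form_eigen_values_def form_eigen_space_def by blast
  next
    assume "1 / m \<in> form_eigen_values"
    then obtain u where u: "u \<in> form_eigen_space (1 / m)" "u \<noteq> (\<lambda>x. 0)" unfolding form_eigen_values_def form_eigen_space_def by blast
    then have "Q u \<in> eigen_space (L2_space S) (L2_inner S) (Q \<circ> G) m"
      using eigen_space_QG[OF m, of "Q u"] lump_L2 by auto
    moreover have "\<not> ip_eq (L2_inner S) (Q u) (\<lambda>x. 0)"
      using zero[OF lump_L2] lump_AE_eq_0 u form_eigen_space_subset by blast
    ultimately show "m \<in> eigen_values (L2_space S) (L2_inner S) (Q \<circ> G)"
      unfolding eigen_values_def by blast
  qed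
  show ?thesis
  proof (intro set_eqI iffI)
    fix m assume "m \<in> eigen_values (L2_space S) (L2_inner S) (Q \<circ> G) - {0}"
    then have "1 / m \<in> form_eigen_values" using iff by blast
    then show "m \<in> (\<lambda>l. 1 / l) ` form_eigen_values" by (intro image_eqI[of _ _ "1 / m"]) auto
  next
    fix m assume "m \<in> (\<lambda>l. 1 / l) ` form_eigen_values"
    then obtain l where l: "l \<in> form_eigen_values" "m = 1 / l" by blast
    then have "m \<noteq> 0" "1 / m \<in> form_eigen_values" using form_eigen_values_pos[OF l(1)] by auto
    then show "m \<in> eigen_values (L2_space S) (L2_inner S) (Q \<circ> G) - {0}" using iff by blast
  qed
qed

text \<open>The relation \<open>q (PQ f) w = (f, Q w)\<close> makes \<open>Q u\<close> satisfy the
  orthogonality conditions for \<open>f\<close>. The projection on L2 is a choice among functions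
  equal almost everywhere, so existence comes first and the chosen function is then compared with
  \<open>Q u\<close>.\<close>

lemma orth_projection_QG:
  assumes f: "f \<in> L2_space S" and l: "l \<in> form_eigen_values"
  shows "AE x in lebesgue_on S.
     orth_projection (L2_inner S) (eigen_space (L2_space S) (L2_inner S) (Q \<circ> G) (1 / l)) f x =
     Q (orth_projection q (form_eigen_space l) (PQ f)) x"
proof -
  have m: "1 / l \<noteq> 0" using form_eigen_values_pos[OF l] by simp
  let ?ES = "eigen_space (L2_space S) (L2_inner S) (Q \<circ> G) (1 / l)"
  have ES: "g \<in> ?ES \<longleftrightarrow> g \<in> L2_space S \<and> (\<exists>u\<in>form_eigen_space l. AE x in lebesgue_on S. g x = Q u x)" for g
    using eigen_space_QG[OF m, of g] by simp
  define u where "u = orth_projection q (form_eigen_space l) (PQ f)"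
  note P = discrete_P_lumped[OF f]
  have uE: "u \<in> form_eigen_space l" and u: "\<And>w. w \<in> form_eigen_space l \<Longrightarrow> q u w = q (PQ f) w"
    using q.orth_projection[OF function_subspace_form_eigen_space form_eigen_space_subset P(1)] unfolding u_def by blast+
  have test: "L2_inner S (\<lambda>x. f x - s x) (Q w) = L2_inner S f (Q w) - L2_inner S s (Q w)"
    if "s \<in> L2_space S" for s w
    by (rule L2_inner_diff_left[OF f that lump_L2])
  \<comment> \<open>Riesz representation is proved only on subspaces of \<open>V\<close>; in L2 the
    projection is exhibited explicitly as \<open>Q u\<close>.\<close>
  have "\<exists>s. s \<in> ?ES \<and> (\<forall>g\<in>?ES. L2_inner S (\<lambda>x. f x - s x) g = 0)"
  proof (intro exI conjI ballI)
    show "Q u \<in> ?ES" unfolding ES using uE lump_L2 by auto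
    fix g assume "g \<in> ?ES"
    then obtain w where w: "w \<in> form_eigen_space l" "AE x in lebesgue_on S. g x = Q w x" and g: "g \<in> L2_space S"
      unfolding ES by blast
    have wV: "w \<in> V" using w(1) form_eigen_space_subset by blast
    have "L2_inner S (\<lambda>x. f x - Q u x) g = L2_inner S g (\<lambda>x. f x - Q u x)"
      by (rule L2_inner_commute)
    also have "\<dots> = L2_inner S (Q w) (\<lambda>x. f x - Q u x)"
      using function_subspace_diff[OF function_subspace_L2 f lump_L2]
      by (rule L2_inner_cong_AE[OF g lump_L2 _ w(2)])
    also have "\<dots> = L2_inner S (\<lambda>x. f x - Q u x) (Q w)" by (rule L2_inner_commute)
    also have "\<dots> = q (PQ f) w - q u w"
      unfolding test[OF lump_L2] P(2)[OF wV] by (simp add: lumped_inner_def)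
    also have "\<dots> = 0" using u[OF w(1)] by simp
    finally show "L2_inner S (\<lambda>x. f x - Q u x) g = 0" .
  qed
  then have "orth_projection (L2_inner S) ?ES f \<in> ?ES \<and>
      (\<forall>g\<in>?ES. L2_inner S (\<lambda>x. f x - orth_projection (L2_inner S) ?ES f x) g = 0)"
    unfolding orth_projection_def by (rule someI_ex)
  then obtain s where s: "s = orth_projection (L2_inner S) ?ES f" "s \<in> ?ES"
    "\<And>g. g \<in> ?ES \<Longrightarrow> L2_inner S (\<lambda>x. f x - s x) g = 0"
    by blast
  then obtain u' where u': "u' \<in> form_eigen_space l" "AE x in lebesgue_on S. s x = Q u' x" and sL: "s \<in> L2_space S"
    unfolding ES by blast
  \<comment> \<open>The chosen projection is \<open>Q u'\<close> almost everywhere; its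
    orthogonality conditions say that \<open>u'\<close> is also the \<open>q\<close>-projection of
    \<open>PQ f\<close>.\<close>
  have "u' = u"
  proof (rule q.ip_cancel[OF function_subspace_form_eigen_space form_eigen_space_subset u'(1) uE])
    fix w assume w: "w \<in> form_eigen_space l"
    have wV: "w \<in> V" using w form_eigen_space_subset by blast
    have "Q w \<in> ?ES" unfolding ES using w lump_L2 by auto
    then have "L2_inner S f (Q w) = L2_inner S s (Q w)" using s(3)[of "Q w"] test[OF sL, of w] by simp
    also have "\<dots> = q u' w"
      unfolding lumped_inner_def by (rule L2_inner_cong_AE[OF sL lump_L2 lump_L2 u'(2)])
    finally show "q u' w = q u w" using u[OF w] P(2)[OF wV] by simp
  qed
  then show ?thesis using u'(2) s(1) unfolding u_def by simp
qed

text \<open>Reindexing by \<open>l \<mapsto> 1 / l\<close> matches the two spectral sums: the powers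
  agree as numbers, the projections almost everywhere.\<close>

lemma L2_power_QG:
  assumes f: "f \<in> L2_space S"
  shows "AE x in lebesgue_on S. L2_power S (Q \<circ> G) \<beta> f x = Q (fractional_TQ bc S T a \<beta> f) x"
proof -
  let ?M = "eigen_values (L2_space S) (L2_inner S) (Q \<circ> G)"
  let ?p = "\<lambda>m. orth_projection (L2_inner S) (eigen_space (L2_space S) (L2_inner S) (Q \<circ> G) m) f"
  let ?u = "\<lambda>l. orth_projection q (form_eigen_space l) (PQ f)"
  have finM: "finite ?M"
    using eigen_values_QG finite_form_eigen_values by (metis finite_Diff2 finite.emptyI finite_imageI finite_insert)
  have inj: "inj_on (\<lambda>l. 1 / l) form_eigen_values" by (rule inj_onI) simp
  have pw: "L2_power S (Q \<circ> G) \<beta> f x = (\<Sum>l\<in>form_eigen_values. l powr (- \<beta>) * ?p (1 / l) x)" for x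
  proof -
    have "L2_power S (Q \<circ> G) \<beta> f x = (\<Sum>m\<in>?M. m powr \<beta> * ?p m x)"
      by (simp add: L2_power_def spectral_fun_def)
    \<comment> \<open>Whether or not 0 is an eigenvalue, its term vanishes because
      \<open>0 powr \<beta> = 0\<close>.\<close>
    also have "\<dots> = (\<Sum>m\<in>?M - {0}. m powr \<beta> * ?p m x)"
      by (rule sum.mono_neutral_right[OF finM]) auto
    also have "\<dots> = (\<Sum>l\<in>form_eigen_values. (1 / l) powr \<beta> * ?p (1 / l) x)"
      unfolding eigen_values_QG using sum.reindex[OF inj] by simp
    also have "\<dots> = (\<Sum>l\<in>form_eigen_values. l powr (- \<beta>) * ?p (1 / l) x)"
    proof (rule sum.cong[OF refl])
      fix l assume "l \<in> form_eigen_values"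
      then have "(1 / l) powr \<beta> = l powr (- \<beta>)"
        using form_eigen_values_pos[of l] by (simp add: powr_divide powr_minus_divide)
      then show "(1 / l) powr \<beta> * ?p (1 / l) x = l powr (- \<beta>) * ?p (1 / l) x" by simp
    qed
    finally show ?thesis .
  qed
  have Qu: "Q (fractional_TQ bc S T a \<beta> f) = (\<lambda>x. \<Sum>l\<in>form_eigen_values. l powr (- \<beta>) * Q (?u l) x)"
    unfolding fractional_TQ_def spectral_fun_def eigen_values_LQ eigen_space_LQ by (rule lump_sum)
  \<comment> \<open>Finitely many exceptional null sets, one per eigenvalue, combine into a single
    null set.\<close>
  have "AE x in lebesgue_on S. \<forall>l\<in>form_eigen_values. ?p (1 / l) x = Q (?u l) x"
    using orth_projection_QG[OF f] by (intro AE_finite_allI finite_form_eigen_values)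
  then show ?thesis
    unfolding pw Qu by eventually_elim simp
qed

end

lemma fractional_TQ_eq:
  assumes "solution_operator G" "f \<in> L2_space S"
  shows "fractional_TQ bc S T a \<beta> f = lump_inverse bc S T (L2_power S (Q \<circ> G) \<beta> f)"
  using lump_inverse_eqI[OF fractional_TQ_in_V[OF assms(2)] L2_power_QG[OF assms]] by simp

lemma lump_in_dual_space: "Q u \<in> dual_space bc S T"
  unfolding dual_space_def lump_def by blast

end

text \<open>The spectral calculus sees the operator only through its eigenspaces inside L2, so
  agreement on L2 suffices. This gives the dependence on \<open>T_h\<close> alone.\<close>

lemma L2_power_cong:
  assumes "\<And>f. f \<in> L2_space S \<Longrightarrow> B f = B' f"
  shows "L2_power S B = L2_power S B'"
proof -
  have "eigen_space (L2_space S) (L2_inner S) B = eigen_space (L2_space S) (L2_inner S) B'"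
    using assms by (intro ext) (simp add: eigen_space_def cong: conj_cong)
  then show ?thesis
    by (simp add: L2_power_def spectral_fun_def eigen_values_def fun_eq_iff)
qed

theorem theorem3p6:
  fixes S :: "(real^'d) set"
    and A :: "real^'d \<Rightarrow> real^'d^'d"
    and \<kappa> :: "real^'d \<Rightarrow> real"
    and bc :: boundary_condition
    and H :: "real set"
    and T :: "real \<Rightarrow> (real^'d) set set"
    and a ip :: "real \<Rightarrow> (real^'d \<Rightarrow> real) \<Rightarrow> (real^'d \<Rightarrow> real) \<Rightarrow> real"
    and h \<beta> :: real
  assumes "CARD('d) \<in> {1, 2, 3}"
    and "polytopal_domain S"
    and "admissible_coefficients S A \<kappa>"
    and "mesh_family S H T"
    and "admissible_form bc S A \<kappa> H T a"
    and "admissible_inner bc S H T ip"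
    and "h \<in> H"
    and "positive_definite_on (fe_space bc S (T h)) (a h)"
    and "\<beta> > 0"
  shows
    "(\<forall>f\<in>L2_space S.
       (\<exists>w\<in>dual_space bc S (T h). AE x in lebesgue_on S.
          L2_power S (lump bc S (T h) \<circ> discrete_T bc S (T h) (ip h) (a h)) \<beta> f x = w x) \<and>
       fractional_TQ bc S (T h) (a h) \<beta> f =
         lump_inverse bc S (T h)
           (L2_power S (lump bc S (T h) \<circ> discrete_T bc S (T h) (ip h) (a h)) \<beta> f)) \<and>
    (\<forall>a' ip'.
       admissible_form bc S A \<kappa> H T a' \<and> admissible_inner bc S H T ip' \<and>
       positive_definite_on (fe_space bc S (T h)) (a' h) \<and>
       (\<forall>f\<in>L2_space S.
          discrete_T bc S (T h) (ip' h) (a' h) f = discrete_T bc S (T h) (ip h) (a h) f) \<longrightarrow>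
       (\<forall>f\<in>L2_space S.
          fractional_TQ bc S (T h) (a' h) \<beta> f = fractional_TQ bc S (T h) (a h) \<beta> f)) \<and>
    (\<forall>ip'. admissible_inner bc S H T ip' \<longrightarrow>
       (\<forall>f\<in>L2_space S.
          fractional_TQ bc S (T h) (a h) \<beta> f =
            lump_inverse bc S (T h)
              (L2_power S (lump bc S (T h) \<circ> discrete_T bc S (T h) (ip' h) (a h)) \<beta> f)))"
proof -
  let ?V = "fe_space bc S (T h)"
  let ?B = "\<lambda>ip a. lump bc S (T h) \<circ> discrete_T bc S (T h) (ip h) (a h)"
  have mesh: "lumped_mesh S (T h)"
    using assms(2,4,7) unfolding polytopal_domain_def mesh_family_def
    by unfold_locales auto
  have problem: "lumped_problem bc S (T h) (a' h)"
    if "admissible_form bc S A \<kappa> H T a'" "positive_definite_on ?V (a' h)" for a'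
    using mesh that assms(7)
    by (auto simp: lumped_problem_def lumped_problem_axioms_def admissible_form_def)
  have sol: "lumped_problem.solution_operator bc S (T h) (a' h) (discrete_T bc S (T h) (ip' h) (a' h))"
    if "admissible_form bc S A \<kappa> H T a'" "positive_definite_on ?V (a' h)"
      "admissible_inner bc S H T ip'" for a' ip'
    using that(3) assms(7)
    by (intro lumped_problem.solution_operator_discrete_T[OF problem[OF that(1,2)]])
      (auto simp: admissible_inner_def)
  \<comment> \<open>Keeping both the form and the auxiliary inner product arbitrary lets this one
    identity serve all three conclusions.\<close>
  have eq: "fractional_TQ bc S (T h) (a' h) \<beta> f = lump_inverse bc S (T h) (L2_power S (?B ip' a') \<beta> f)"
    if "admissible_form bc S A \<kappa> H T a'" "positive_definite_on ?V (a' h)"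
      "admissible_inner bc S H T ip'" "f \<in> L2_space S" for a' ip' f
    by (rule lumped_problem.fractional_TQ_eq[OF problem[OF that(1,2)] sol[OF that(1-3)] that(4)])
  show ?thesis
  proof (intro conjI ballI allI impI)
    fix f assume f: "f \<in> L2_space S"
    \<comment> \<open>The witness is the lumping of \<open>fractional_TQ\<close>, which lies in the
      dual space by construction.\<close>
    show "\<exists>w\<in>dual_space bc S (T h). AE x in lebesgue_on S. L2_power S (?B ip a) \<beta> f x = w x"
      using lumped_problem.L2_power_QG[OF problem[OF assms(5,8)] sol[OF assms(5,8,6)] f]
      by (intro bexI[OF _ lumped_problem.lump_in_dual_space[OF problem[OF assms(5,8)]]])
    show "fractional_TQ bc S (T h) (a h) \<beta> f = lump_inverse bc S (T h) (L2_power S (?B ip a) \<beta> f)"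
      by (rule eq[OF assms(5,8,6) f])
  next
    fix a' ip' f
    assume *: "admissible_form bc S A \<kappa> H T a' \<and> admissible_inner bc S H T ip' \<and>
       positive_definite_on ?V (a' h) \<and>
       (\<forall>f\<in>L2_space S.
          discrete_T bc S (T h) (ip' h) (a' h) f = discrete_T bc S (T h) (ip h) (a h) f)"
      and f: "f \<in> L2_space S"
    \<comment> \<open>Equal nonfractional operators have equal powers, and both fractional operators
      are the lump inverse of that common power.\<close>
    have "L2_power S (?B ip' a') = L2_power S (?B ip a)"
      using * by (intro L2_power_cong) simp
    then show "fractional_TQ bc S (T h) (a' h) \<beta> f = fractional_TQ bc S (T h) (a h) \<beta> f"
      using eq[of a' ip' f] eq[OF assms(5,8,6) f] * f by simp
  next
    fix ip' f assume "admissible_inner bc S H T ip'" "f \<in> L2_space S"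
    then show "fractional_TQ bc S (T h) (a h) \<beta> f = lump_inverse bc S (T h) (L2_power S (?B ip' a) \<beta> f)"
      by (rule eq[OF assms(5,8)])
  qed
qed

end
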